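(* Let $Z\in\mathbb{D}^{1,2}$ have mean $0$ and support $(l,u)$, $-\infty\le l<0<u\le\infty$, with a density $\rho_*$ that is continuous on $(l,u)$. Assume that if $u=\infty$ then $\varliminf_{x\to u}g_*(x)>0$, and that if $l=-\infty$ then $\varliminf_{x\to l}g_*(x)>0$. Suppose there exists a positive function $\tilde g\in\mathcal{C}^1(l,u)$ such that 1. $0<\varliminf_{x\to u}\frac{g_*(x)}{\tilde g(x)}\le\varlimsup_{x\to u}\frac{g_*(x)}{\tilde g(x)}<\infty$ and $\tilde g'(u^-):=\lim_{x\to u^-}\tilde g'(x)$ exists in $[-\infty,\infty]$; 2. $0<\varliminf_{x\to l}\frac{g_*(x)}{\tilde g(x)}\le\varlimsup_{x\to l}\frac{g_*(x)}{\tilde g(x)}<\infty$ and $\tilde g'(l^+):=\lim_{x\to l^+}\tilde g'(x)$ exists in $[-\infty,\infty]$. Then there is a finite constant $k$, depending on $Z$ alone, such that for every test function $h$ with $\|h'\|_\infty<\infty$, the solution $f=f_h$ of the Stein equation $$g_*(x)f'(x)-xf(x)=h(x)-\mathbb{E}[h(Z)],\qquad x\in(l,u),$$ given by $f(x)=\frac{1}{g_*(x)\rho_*(x)}\int_l^x\bigl(h(y)-\mathbb{E}[h(Z)]\bigr)\rho_*(y)\,dy$, satisfies $$\|f'\|_\infty\le k\,\|h'\|_\infty .$$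
   Context: Let $\mathfrak{H}$ be a real separable Hilbert space and $W$ an isonormal Gaussian process over $\mathfrak{H}$ on a probability space $(\Omega,\mathcal{F},\mathbb{P})$, with $\mathcal{F}$ generated by $W$. $D$ is the Malliavin derivative, with domain $\mathbb{D}^{1,2}\subset L^2(\Omega)$; if $F=\sum_{q\ge0}I_q(f_q)$ is the Wiener chaos decomposition, $LF=-\sum_{q\ge1}qI_q(f_q)$ and $L^{-1}F=-\sum_{q\ge1}\frac1qI_q(f_q)$. The function $g_*$ attached to $Z$ is $g_*(z)=\mathbb{E}[\langle DZ,-DL^{-1}Z\rangle_{\mathfrak{H}}\mid Z=z]$, taken in the version $$g_*(z)=\frac{1}{\rho_*(z)}\int_z^u y\rho_*(y)\,dy=-\frac{1}{\rho_*(z)}\int_l^z y\rho_*(y)\,dy,\qquad z\in(l,u),$$ which is strictly positive on $(l,u)$. Test functions $h:\mathbb{R}\to\mathbb{R}$ are Lipschitz, hence differentiable almost everywhere, with $\|h'\|_\infty$ the (essential) supremum of $|h'|$; $\|f'\|_\infty$ is the supremum over $(l,u)$. *)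

theory Defs
  imports "HOL-Probability.Probability"
begin

section \<open>Smooth functions of finitely many variables\<close>

text \<open>
  A function on \<open>\<real>\<^sup>n\<close>, with \<open>n\<close> ranging over all natural numbers, is represented by a function
  on \<open>nat \<Rightarrow> real\<close> that depends on the coordinates below \<open>n\<close> only.  The type \<open>nat \<Rightarrow> real\<close>
  carries the product topology, so for such functions continuity is continuity on \<open>\<real>\<^sup>n\<close>.
\<close>

definition partial_deriv :: "nat \<Rightarrow> ((nat \<Rightarrow> real) \<Rightarrow> real) \<Rightarrow> (nat \<Rightarrow> real) \<Rightarrow> real" where
  "partial_deriv i \<phi> x = deriv (\<lambda>t. \<phi> (x(i := t))) (x i)"

text \<open>
  The class \<open>C\<^sub>p\<^sup>\<infinity>(\<real>\<^sup>n)\<close>: all iterated partial derivatives (indexed by lists of coordinates, the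
  empty list giving \<open>\<phi>\<close> itself) exist, are continuous and grow at most polynomially.
\<close>

definition smooth_poly_growth :: "nat \<Rightarrow> ((nat \<Rightarrow> real) \<Rightarrow> real) \<Rightarrow> bool" where
  "smooth_poly_growth n \<phi> \<longleftrightarrow>
     (\<forall>x y. (\<forall>i<n. x i = y i) \<longrightarrow> \<phi> x = \<phi> y) \<and>
     (\<forall>js. set js \<subseteq> {..<n} \<longrightarrow>
        (let \<psi> = fold partial_deriv js \<phi> in
           continuous_on UNIV \<psi> \<and>
           (\<forall>i<n. \<forall>x. (\<lambda>t. \<psi> (x(i := t))) differentiable (at (x i))) \<and>
           (\<exists>C m. \<forall>x. \<bar>\<psi> x\<bar> \<le> C * (1 + (\<Sum>i<n. \<bar>x i\<bar>)) ^ m)))"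

fun hermite :: "nat \<Rightarrow> real \<Rightarrow> real" where
  "hermite 0 x = 1"
| "hermite (Suc 0) x = x"
| "hermite (Suc (Suc q)) x = x * hermite (Suc q) x - real (Suc q) * hermite q x"

section \<open>Isonormal Gaussian processes and the Malliavin derivative\<close>

context prob_space
begin

text \<open>Centred Gaussian random variables; the degenerate case of variance \<open>0\<close> is included.\<close>

definition centred_gaussian :: "('a \<Rightarrow> real) \<Rightarrow> bool" where
  "centred_gaussian X \<longleftrightarrow> X \<in> borel_measurable M \<and>
     ((AE \<omega> in M. X \<omega> = 0) \<or>
      (\<exists>\<sigma>>0. distributed M lborel X (\<lambda>x. ennreal (normal_density 0 \<sigma> x))))"

definition L2 :: "('a \<Rightarrow> 'b::{banach, second_countable_topology}) set" where
  "L2 = {X \<in> borel_measurable M. integrable M (\<lambda>\<omega>. (norm (X \<omega>))\<^sup>2)}"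

definition L2_tendsto ::
  "(nat \<Rightarrow> 'a \<Rightarrow> 'b::{banach, second_countable_topology}) \<Rightarrow> ('a \<Rightarrow> 'b) \<Rightarrow> bool" where
  "L2_tendsto X Y \<longleftrightarrow> (\<lambda>n. \<integral>\<^sup>+ \<omega>. ennreal ((norm (X n \<omega> - Y \<omega>))\<^sup>2) \<partial>M) \<longlonglongrightarrow> 0"

end

text \<open>
  The last assumption says that the sigma-algebra of the probability space is generated by \<open>W\<close>.
  Separability of the Hilbert space is second countability of its metric topology.
\<close>

locale isonormal_gaussian = prob_space M
  for M :: "'a measure" +
  fixes W :: "'h::{real_inner, banach, second_countable_topology} \<Rightarrow> 'a \<Rightarrow> real"
  assumes gaussian: "\<And>(n::nat) c e. centred_gaussian (\<lambda>\<omega>. \<Sum>i<n. c i * W (e i) \<omega>)"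
    and covariance: "\<And>e e'. expectation (\<lambda>\<omega>. W e \<omega> * W e' \<omega>) = e \<bullet> e'"
    and generated:
      "sets M = sigma_sets (space M) (\<Union>e. {W e -` B \<inter> space M | B. B \<in> sets borel})"
begin

definition smooth_rv_deriv :: "('a \<Rightarrow> real) \<Rightarrow> ('a \<Rightarrow> 'h) \<Rightarrow> bool" where
  "smooth_rv_deriv F G \<longleftrightarrow>
     (\<exists>n \<phi> e. smooth_poly_growth n \<phi> \<and>
        F = (\<lambda>\<omega>. \<phi> (\<lambda>i. W (e i) \<omega>)) \<and>
        G = (\<lambda>\<omega>. \<Sum>i<n. partial_deriv i \<phi> (\<lambda>i. W (e i) \<omega>) *\<^sub>R e i))"

text \<open>
  The graph of the Malliavin derivative is the closure, in
  \<open>L\<^sup>2(\<Omega>) \<times> L\<^sup>2(\<Omega>; H)\<close>, of its graph on smooth random variables.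
\<close>

definition has_malliavin_deriv :: "('a \<Rightarrow> real) \<Rightarrow> ('a \<Rightarrow> 'h) \<Rightarrow> bool" where
  "has_malliavin_deriv F G \<longleftrightarrow> F \<in> L2 \<and> G \<in> L2 \<and>
     (\<exists>Fn Gn. (\<forall>n. smooth_rv_deriv (Fn n) (Gn n)) \<and> L2_tendsto Fn F \<and> L2_tendsto Gn G)"

definition D12 :: "('a \<Rightarrow> real) set" where
  "D12 = {F. \<exists>G. has_malliavin_deriv F G}"

text \<open>A version of the Malliavin derivative, which is unique almost everywhere.\<close>

definition malliavin_D :: "('a \<Rightarrow> real) \<Rightarrow> 'a \<Rightarrow> 'h" where
  "malliavin_D F = (SOME G. has_malliavin_deriv F G)"

text \<open>
  The \<open>q\<close>-th Wiener chaos is the closed linear span in \<open>L\<^sup>2(\<Omega>)\<close> of the variables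
  \<open>H\<^sub>q(W(e))\<close> with \<open>\<parallel>e\<parallel> = 1\<close>.  It is the range of the multiple integral \<open>I\<^sub>q\<close>.  The disjunct \<open>q = 0\<close>
  makes chaos \<open>0\<close> the constants even if the Hilbert space is trivial.
\<close>

definition wiener_chaos :: "nat \<Rightarrow> ('a \<Rightarrow> real) set" where
  "wiener_chaos q = {F \<in> L2. \<exists>Fn. L2_tendsto Fn F \<and>
     (\<forall>n. \<exists>(m::nat) c e. (\<forall>i<m. q = 0 \<or> norm (e i) = 1) \<and>
        Fn n = (\<lambda>\<omega>. \<Sum>i<m. c i * hermite q (W (e i) \<omega>)))}"

text \<open>\<open>chaos_decomposition F J\<close>: here \<open>J q\<close> is the component \<open>I\<^sub>q(f\<^sub>q)\<close> of \<open>F\<close>.\<close>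

definition chaos_decomposition :: "('a \<Rightarrow> real) \<Rightarrow> (nat \<Rightarrow> 'a \<Rightarrow> real) \<Rightarrow> bool" where
  "chaos_decomposition F J \<longleftrightarrow> F \<in> L2 \<and> (\<forall>q. J q \<in> wiener_chaos q) \<and>
     L2_tendsto (\<lambda>N \<omega>. \<Sum>q<N. J q \<omega>) F"

definition L_inv :: "('a \<Rightarrow> real) \<Rightarrow> 'a \<Rightarrow> real" where
  "L_inv F = (SOME G. G \<in> L2 \<and> (\<exists>J. chaos_decomposition F J \<and>
     L2_tendsto (\<lambda>N \<omega>. - (\<Sum>q=1..N. J q \<omega> / real q)) G))"

text \<open>\<open>\<langle>DF, -DL\<^sup>-\<^sup>1F\<rangle>\<close>, conditioned on \<open>F\<close>.\<close>

definition cond_stein_kernel :: "('a \<Rightarrow> real) \<Rightarrow> 'a \<Rightarrow> real" where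
  "cond_stein_kernel F =
     real_cond_exp M (vimage_algebra (space M) F borel)
       (\<lambda>\<omega>. malliavin_D F \<omega> \<bullet> (- malliavin_D (L_inv F) \<omega>))"

end

section \<open>Laws on an interval and the Stein equation\<close>

definition measure_support :: "'a::topological_space measure \<Rightarrow> 'a set" where
  "measure_support \<mu> = {x. \<forall>U. open U \<longrightarrow> x \<in> U \<longrightarrow> emeasure \<mu> U > 0}"

text \<open>The filters \<open>x \<rightarrow> u\<close> and \<open>x \<rightarrow> l\<close> from inside an interval with endpoints \<open>l < u\<close>.\<close>

definition to_upper :: "ereal \<Rightarrow> real filter" where
  "to_upper u = (if u = \<infinity> then at_top else at_left (real_of_ereal u))"

definition to_lower :: "ereal \<Rightarrow> real filter" where
  "to_lower l = (if l = -\<infinity> then at_bot else at_right (real_of_ereal l))"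

text \<open>The parameter \<open>m\<close> stands for \<open>E[h(Z)]\<close>.\<close>

definition stein_solution ::
  "(real \<Rightarrow> real) \<Rightarrow> (real \<Rightarrow> real) \<Rightarrow> ereal \<Rightarrow> (real \<Rightarrow> real) \<Rightarrow> real \<Rightarrow> real \<Rightarrow> real" where
  "stein_solution g \<rho> l h m x = 1 / (g x * \<rho> x) * (LBINT y=l..ereal x. (h y - m) * \<rho> y)"

text \<open>
  The values of \<open>deriv h\<close> where \<open>h\<close> is not differentiable are irrelevant when \<open>h\<close> is Lipschitz,
  since they concern a null set only.
\<close>

definition deriv_esssup :: "(real \<Rightarrow> real) \<Rightarrow> ereal" where
  "deriv_esssup h = esssup lebesgue (\<lambda>x. ereal \<bar>deriv h x\<bar>)"

end

theory Submission
  imports Defs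
begin

text \<open>
  Put \<open>\<phi> = g * \<rho>\<close> on \<open>(l, u)\<close>; then \<open>\<phi> x\<close> is the integral of \<open>y * \<rho> y\<close> over \<open>(x, u)\<close>, and
  \<open>\<phi>' x = - x * \<rho> x\<close>.  Let \<open>V\<close> and \<open>T = 1 - V\<close> be the distribution function and the tail of \<open>Z\<close>.
  For a \<open>K\<close>-Lipschitz \<open>h\<close>, splitting the integrals of \<open>(h - h x) * \<rho>\<close> at \<open>x\<close> expresses the
  derivative of the Stein solution through the two parts, and each part is bounded by \<open>K\<close> times a
  first moment of \<open>\<rho>\<close> about \<open>x\<close>.  These moments are \<open>\<phi> x + x * V x\<close> to the left of \<open>x\<close> and
  \<open>\<phi> x - x * T x\<close> to the right, and the outcome (\<open>stein_solution_derivative\<close>) is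
  \<open>\<bar>f' x\<bar> \<le> 2 * K * (\<phi> x - x * T x) * (\<phi> x + x * V x) / (\<phi> x * g x)\<close>.

  The factor of \<open>K\<close> depends on the law of \<open>Z\<close> alone and is continuous on \<open>(l, u)\<close>, so it has to be
  bounded near the two ends (\<open>product_estimate\<close>), and reflection reduces the lower end to the upper one.
  Near \<open>u\<close> everything rests on \<open>x * (\<phi> x - x * T x) \<le> C * \<phi> x * g x\<close> (\<open>tail_estimate\<close>).  As \<open>g\<close> is
  comparable to a \<open>C\<^sup>1\<close> function \<open>G\<close> whose derivative has a limit, there are two cases near \<open>u\<close>.  Either \<open>G\<close>,
  and with it \<open>g\<close>, dominates a positive multiple of \<open>x\<close>, and the inequality follows from \<open>T \<ge> 0\<close>.  Or
  \<open>G'\<close> is too small to compete with \<open>x * G / g\<close>; then \<open>\<phi> * G / x\<^sup>2\<close> decreases at least at a fixed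
  multiple of the rate \<open>\<phi> / x\<^sup>2\<close> at which \<open>\<phi> / x - T\<close> decreases, and comparing the two
  functions from the end \<open>u\<close>, where the latter tends to \<open>0\<close>, gives the inequality.

  It remains to pass from the essential supremum of \<open>\<bar>deriv h\<bar>\<close> to a Lipschitz constant of \<open>h\<close>
  (\<open>lipschitz_on_deriv_bound_AE\<close>).  This requires that Lipschitz functions on the line are
  differentiable almost everywhere, which is proved with the Vitali covering theorem.
\<close>

section \<open>Lipschitz functions on the line and their derivatives\<close>

text \<open>
  The Vitali covering theorem for closed balls, rephrased for intervals.  The closed intervals it
  selects are replaced by their interiors, which loses only countably many endpoints: the union is
  then open, so that a second covering can be carried out inside it.
\<close>
lemma Vitali_covering_by_intervals:
  fixes E O' :: "real set" and P :: "real \<Rightarrow> real \<Rightarrow> bool"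
  assumes "open O'" "E \<subseteq> O'"
    and fine: "\<And>x d. x \<in> E \<Longrightarrow> 0 < d \<Longrightarrow> \<exists>s t. s < t \<and> s \<le> x \<and> x \<le> t \<and> t - s < d \<and> P s t"
  obtains I :: "(real \<times> real) set" where
    "countable I" "\<And>s t. (s, t) \<in> I \<Longrightarrow> s < t \<and> P s t \<and> {s<..<t} \<subseteq> O'"
    "disjoint_family_on (\<lambda>(s, t). {s<..<t}) I"
    "negligible (E - (\<Union>(s, t)\<in>I. {s<..<t}))"
proof -
  define K where "K = {(s, t). s < t \<and> P s t \<and> {s..t} \<subseteq> O'}"
  define a r where "a = (\<lambda>(s::real, t). (s + t) / 2)" and "r = (\<lambda>(s::real, t). (t - s) / 2)"
  have cb: "cball (a i) (r i) = {fst i..snd i}" for i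
    by (cases i) (auto simp: a_def r_def cball_eq_atLeastAtMost field_simps)
  have 1: "\<And>i. i \<in> K \<Longrightarrow> 0 < r i"
    by (auto simp: K_def r_def)
  have 2: "\<exists>i. i \<in> K \<and> x \<in> cball (a i) (r i) \<and> r i < d" if "x \<in> E" "0 < d" for x d
  proof -
    from \<open>x \<in> E\<close> assms obtain e where e: "0 < e" "ball x e \<subseteq> O'"
      by (meson openE subsetD)
    obtain s t where st: "s < t" "s \<le> x" "x \<le> t" "t - s < min d e" "P s t"
      using fine[OF \<open>x \<in> E\<close>, of "min d e"] e \<open>0 < d\<close> by auto
    have "{s..t} \<subseteq> ball x e"
      using st by (auto simp: dist_real_def)
    with st e have "(s, t) \<in> K"
      by (auto simp: K_def)
    moreover have "x \<in> cball (a (s, t)) (r (s, t))"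
      unfolding cb using st by auto
    moreover have "r (s, t) < d" using st by (auto simp: r_def)
    ultimately show ?thesis by blast
  qed
  obtain I where I: "countable I" "I \<subseteq> K"
     "pairwise (\<lambda>i j. disjnt (cball (a i) (r i)) (cball (a j) (r j))) I"
     "negligible (E - (\<Union>i \<in> I. cball (a i) (r i)))"
    using Vitali_covering_theorem_cballs[of K r E a, OF 1 2] by blast
  show thesis
  proof
    show "countable I" by fact
    show "\<And>s t. (s, t) \<in> I \<Longrightarrow> s < t \<and> P s t \<and> {s<..<t} \<subseteq> O'"
      using I(2) by (fastforce simp: K_def)
    show "disjoint_family_on (\<lambda>(s, t). {s<..<t}) I"
      using I(3) unfolding disjoint_family_on_def pairwise_def disjnt_def cb by fastforce
    have "countable (\<Union>i\<in>I. {fst i, snd i})"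
      using I(1) by (intro countable_UN) auto
    then have "negligible (\<Union>i\<in>I. {fst i, snd i})"
      by (simp add: negligible_iff_null_sets countable_imp_null_set_lborel null_sets_completionI)
    from negligible_Un[OF I(4) this]
    show "negligible (E - (\<Union>(s, t)\<in>I. {s<..<t}))"
      by (rule negligible_subset) (force simp: cb)
  qed
qed

lemma emeasure_disjoint_UN_le:
  assumes "countable I" "disjoint_family_on X I"
    and "\<And>i. i \<in> I \<Longrightarrow> X i \<in> sets M" "\<And>i. i \<in> I \<Longrightarrow> X i \<in> sets N"
    and "\<And>i. i \<in> I \<Longrightarrow> emeasure M (X i) \<le> c * emeasure N (X i)"
  shows "emeasure M (\<Union>i\<in>I. X i) \<le> c * emeasure N (\<Union>i\<in>I. X i)"
proof -
  have "emeasure M (\<Union>i\<in>I. X i) = (\<integral>\<^sup>+i. emeasure M (X i) \<partial>count_space I)"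
    by (rule emeasure_UN_countable) (use assms in auto)
  also have "\<dots> \<le> (\<integral>\<^sup>+i. c * emeasure N (X i) \<partial>count_space I)"
    by (intro nn_integral_mono) (use assms in auto)
  also have "\<dots> = c * (\<integral>\<^sup>+i. emeasure N (X i) \<partial>count_space I)"
    by (rule nn_integral_cmult) auto
  also have "(\<integral>\<^sup>+i. emeasure N (X i) \<partial>count_space I) = emeasure N (\<Union>i\<in>I. X i)"
    by (rule emeasure_UN_countable[symmetric]) (use assms in auto)
  finally show ?thesis .
qed

text \<open>
  The measure is the image of Lebesgue measure under the inverse of \<open>F\<close>, so a Borel set \<open>A\<close> gets the
  Lebesgue measure of \<open>F ` A\<close>.  In this form absolute continuity is the fact that Lipschitz images of
  negligible sets are negligible.
\<close>
lemma stieltjes_measure_of_bilipschitz: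
  fixes F :: "real \<Rightarrow> real"
  assumes slope: "\<And>x y. x \<le> y \<Longrightarrow> y - x \<le> F y - F x \<and> F y - F x \<le> D * (y - x)"
  obtains \<nu> :: "real measure" where "sets \<nu> = sets borel"
    "\<And>s t. s \<le> t \<Longrightarrow> emeasure \<nu> {s<..<t} = ennreal (F t - F s)"
    "\<And>N. negligible N \<Longrightarrow> N \<in> sets borel \<Longrightarrow> emeasure \<nu> N = 0"
proof -
  have less: "F x < F y \<longleftrightarrow> x < y" for x y
    using slope[of x y] slope[of y x] by (cases x y rule: linorder_cases) auto
  then have inj: "inj F"
    by (metis injI less_irrefl linorder_cases)
  have lip: "\<bar>F x - F y\<bar> \<le> D * \<bar>x - y\<bar>" for x y
    using slope[of x y] slope[of y x] by (cases x y rule: le_cases) auto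
  have D: "0 \<le> D" using lip[of 0 1] by auto
  then have "D-lipschitz_on UNIV F"
    using lip by (auto simp: lipschitz_on_def dist_real_def)
  then have cont: "continuous_on UNIV F"
    by (rule lipschitz_on_continuous_on)
  have "\<exists>x. F x = y" for y
  proof -
    define B where "B = \<bar>y - F 0\<bar>"
    have "F (-B) \<le> y" "y \<le> F B" "- B \<le> B"
      using slope[of "-B" 0] slope[of 0 B] by (auto simp: B_def)
    then show ?thesis
      using IVT'[of F "-B" y B] continuous_on_subset[OF cont] by auto
  qed
  then have surj: "surj F" by (metis surjI)
  define G where "G = inv F"
  have FG: "F (G y) = y" for y by (simp add: G_def surj surj_f_inv_f)
  have GF: "G (F x) = x" for x by (simp add: G_def inj)
  have "mono G"
    by (metis FG less linorder_not_le monoI)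
  then have meas[measurable]: "G \<in> borel_measurable borel"
    by (rule borel_measurable_mono)
  have vim: "G -` A = F ` A" for A
    by (auto simp: GF image_iff) (metis FG)
  show thesis
  proof
    show "sets (distr lborel borel G) = sets borel" by simp
    fix s t :: real assume "s \<le> t"
    have "F ` {s<..<t} = {F s<..<F t}"
    proof (intro subset_antisym subsetI)
      fix y assume "y \<in> {F s<..<F t}"
      then have "F s < F (G y)" "F (G y) < F t" by (simp_all add: FG)
      then have "G y \<in> {s<..<t}" by (simp add: less)
      then show "y \<in> F ` {s<..<t}" by (metis FG imageI)
    qed (auto simp: less)
    moreover have "F s \<le> F t" using slope[of s t] \<open>s \<le> t\<close> by auto
    ultimately show "emeasure (distr lborel borel G) {s<..<t} = ennreal (F t - F s)"
      by (simp add: emeasure_distr vim)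
  next
    fix N :: "real set" assume N: "negligible N" "N \<in> sets borel"
    have "negligible (F ` N)"
      using N(1) by (rule negligible_locally_Lipschitz_image[rotated])
        (use lip in \<open>auto intro!: exI[of _ UNIV]\<close>)
    moreover have "F ` N \<in> sets borel"
      using measurable_sets[OF meas N(2)] by (simp add: vim)
    ultimately have "emeasure lborel (F ` N) = 0"
      by (simp add: negligible_iff_null_sets null_sets_def)
    then show "emeasure (distr lborel borel G) N = 0"
      using N by (simp add: emeasure_distr vim)
  qed
qed

text \<open>
  Two nested coverings compare the increments of \<open>F\<close> with lengths in opposite directions.  Intervals of
  slope at most \<open>p\<close> cover \<open>E\<close> inside an open set barely larger than a measurable hull of \<open>E\<close>; intervals
  of slope at least \<open>q\<close> cover \<open>E\<close> inside the first family.  With \<open>m\<close> the outer measure of \<open>E\<close> this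
  gives \<open>q m \<le> p m\<close>, which forces \<open>m = 0\<close>.
\<close>
lemma negligible_distinct_derivates:
  fixes F :: "real \<Rightarrow> real"
  assumes slope: "\<And>x y. x \<le> y \<Longrightarrow> y - x \<le> F y - F x \<and> F y - F x \<le> D * (y - x)"
    and pq: "0 < p" "p < q" and "bounded E"
    and lo: "\<And>x d. x \<in> E \<Longrightarrow> 0 < d \<Longrightarrow>
      \<exists>s t. s < t \<and> s \<le> x \<and> x \<le> t \<and> t - s < d \<and> F t - F s \<le> p * (t - s)"
    and hi: "\<And>x d. x \<in> E \<Longrightarrow> 0 < d \<Longrightarrow>
      \<exists>s t. s < t \<and> s \<le> x \<and> x \<le> t \<and> t - s < d \<and> q * (t - s) \<le> F t - F s"
  shows "negligible E"
proof -
  obtain \<nu> :: "real measure" where \<nu>: "sets \<nu> = sets borel"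
    "\<And>s t. s \<le> t \<Longrightarrow> emeasure \<nu> {s<..<t} = ennreal (F t - F s)"
    "\<And>N. negligible N \<Longrightarrow> N \<in> sets borel \<Longrightarrow> emeasure \<nu> N = 0"
    by (rule stieltjes_measure_of_bilipschitz[OF slope]) (assumption | rule that)+
  obtain T where T: "T \<in> sets lebesgue" "E \<subseteq> T"
    "outer_measure_of lebesgue E = emeasure lebesgue T"
    using outer_measure_of_attain[of E lebesgue] by auto
  obtain R where R: "E \<subseteq> cball 0 R" using \<open>bounded E\<close> by (auto simp: bounded_iff subset_eq)
  have "emeasure lebesgue T \<le> emeasure lebesgue (cball (0::real) R)"
    using outer_measure_of_mono[OF R, of lebesgue] T(3) by simp
  also have "\<dots> < \<infinity>"
    using emeasure_lborel_cball_finite[of 0 R] by simp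
  finally obtain m where m: "0 \<le> m" "emeasure lebesgue T = ennreal m"
    by (cases "emeasure lebesgue T") auto
  have le: "q * m \<le> p * (m + e)" if "0 < e" for e
  proof -
    obtain O' where O': "open O'" "T \<subseteq> O'" "O' - T \<in> lmeasurable" "emeasure lebesgue (O' - T) < ennreal e"
      using sets_lebesgue_outer_open[OF T(1) \<open>0 < e\<close>] .
    have "emeasure lebesgue O' \<le> emeasure lebesgue T + emeasure lebesgue (O' - T)"
      using T O' by (subst emeasure_Un[symmetric]) (auto simp: Un_absorb1 fmeasurable_def)
    also have "\<dots> \<le> ennreal (m + e)"
      using m O'(4) \<open>0 < e\<close> by (auto simp: add_left_mono)
    finally have mO: "emeasure lebesgue O' \<le> ennreal (m + e)" .
    obtain I where I: "countable I"
      "\<And>s t. (s, t) \<in> I \<Longrightarrow> s < t \<and> F t - F s \<le> p * (t - s) \<and> {s<..<t} \<subseteq> O'"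
      "disjoint_family_on (\<lambda>(s, t). {s<..<t}) I"
      "negligible (E - (\<Union>(s, t)\<in>I. {s<..<t}))"
      by (rule Vitali_covering_by_intervals[OF O'(1) order_trans[OF T(2) O'(2)] lo]) (assumption | rule that)+
    define U where "U = (\<Union>(s, t)\<in>I. {s<..<t})"
    have "open U" unfolding U_def by auto
    obtain J where J: "countable J"
      "\<And>s t. (s, t) \<in> J \<Longrightarrow> s < t \<and> q * (t - s) \<le> F t - F s \<and> {s<..<t} \<subseteq> U"
      "disjoint_family_on (\<lambda>(s, t). {s<..<t}) J"
      "negligible (E \<inter> U - (\<Union>(s, t)\<in>J. {s<..<t}))"
      by (rule Vitali_covering_by_intervals[OF \<open>open U\<close> Int_lower2 hi[OF IntD1]]) (assumption | rule that)+
    define V where "V = (\<Union>(s, t)\<in>J. {s<..<t})"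
    have "open V" unfolding V_def by auto
    have "V \<subseteq> U" using J(2) unfolding V_def by fastforce
    have "negligible (E - V)"
      using negligible_Un[OF I(4) J(4)] unfolding U_def[symmetric] V_def[symmetric]
      by (rule negligible_subset) auto
    then have "V \<union> (E - V) \<in> sets lebesgue"
      using \<open>open V\<close> by (intro sets.Un) (auto dest: negligible_imp_sets)
    then have "outer_measure_of lebesgue E \<le> emeasure lebesgue (V \<union> (E - V))"
      using outer_measure_of_mono[of E "V \<union> (E - V)" lebesgue] by simp
    also have "\<dots> = emeasure lebesgue V"
      using \<open>negligible (E - V)\<close> \<open>open V\<close>
      by (intro emeasure_Un_null_set) (auto simp: negligible_iff_null_sets)
    also have "\<dots> = emeasure lborel V" using \<open>open V\<close> by auto
    also have "\<dots> \<le> ennreal (1 / q) * emeasure \<nu> V"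
      unfolding V_def
    proof (rule emeasure_disjoint_UN_le)
      fix i assume "i \<in> J"
      then show "emeasure lborel (case i of (s, t) \<Rightarrow> {s<..<t})
          \<le> ennreal (1 / q) * emeasure \<nu> (case i of (s, t) \<Rightarrow> {s<..<t})"
        using J(2)[of "fst i" "snd i"] pq
        by (auto simp: \<nu> ennreal_mult'[symmetric] split_beta field_simps intro!: ennreal_leI)
    qed (use J \<nu> in auto)
    also have "emeasure \<nu> V \<le> emeasure \<nu> U"
      using \<open>V \<subseteq> U\<close> \<open>open U\<close> by (intro emeasure_mono) (auto simp: \<nu>)
    also have "emeasure \<nu> U \<le> ennreal p * emeasure lborel U"
      unfolding U_def
    proof (rule emeasure_disjoint_UN_le)
      fix i assume "i \<in> I"
      then show "emeasure \<nu> (case i of (s, t) \<Rightarrow> {s<..<t})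
          \<le> ennreal p * emeasure lborel (case i of (s, t) \<Rightarrow> {s<..<t})"
        using I(2)[of "fst i" "snd i"] pq
        by (auto simp: \<nu> ennreal_mult'[symmetric] split_beta field_simps intro!: ennreal_leI)
    qed (use I \<nu> in auto)
    also have "emeasure lborel U \<le> emeasure lebesgue O'"
    proof -
      have "U \<subseteq> O'" using I(2) unfolding U_def by fastforce
      then have "emeasure lebesgue U \<le> emeasure lebesgue O'"
        using O'(1) by (intro emeasure_mono) auto
      then show ?thesis using \<open>open U\<close> by auto
    qed
    also note mO
    finally have "ennreal m \<le> ennreal (1 / q) * (ennreal p * ennreal (m + e))"
      unfolding T(3) m(2) by (auto simp: mult_left_mono)
    also have "\<dots> = ennreal (1 / q * (p * (m + e)))"
      using pq m \<open>0 < e\<close> by (simp add: ennreal_mult'[symmetric] del: ennreal_plus)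
    finally have "m \<le> 1 / q * (p * (m + e))"
      using pq m \<open>0 < e\<close> by (subst (asm) ennreal_le_iff) auto
    then show ?thesis using pq by (simp add: field_simps)
  qed
  have "q * m \<le> p * m"
  proof (rule field_le_epsilon)
    fix e :: real assume "0 < e"
    moreover have "p * (m + e / p) = p * m + e" using pq by (simp add: field_simps)
    ultimately show "q * m \<le> p * m + e"
      using le[of "e / p"] pq by simp
  qed
  then have "m = 0" using pq m(1) by (auto simp: mult_le_cancel_right)
  then have "T \<in> null_sets lebesgue" using m T by auto
  then show ?thesis
    using T(2) negligible_iff_null_sets negligible_subset by blast
qed


text \<open>
  Adding the linear function with slope \<open>C + 1\<close> makes \<open>h\<close> strictly increasing with slopes between \<open>1\<close>
  and \<open>2 * C + 1\<close>, without changing where it is differentiable.  Where the difference quotients do not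
  converge, their lower and upper limits are separated by two rationals, and
  \<open>negligible_distinct_derivates\<close> applies to each of the countably many pairs of rationals.
\<close>
lemma lipschitz_imp_differentiable_AE:
  fixes h :: "real \<Rightarrow> real"
  assumes "C-lipschitz_on UNIV h"
  shows "negligible {x. \<not> h differentiable (at x)}"
proof -
  have C: "0 \<le> C" "\<bar>h x - h y\<bar> \<le> C * \<bar>x - y\<bar>" for x y
    using assms by (auto simp: lipschitz_on_def dist_real_def)
  define F where "F x = h x + (C + 1) * x" for x
  have slope: "y - x \<le> F y - F x \<and> F y - F x \<le> (2 * C + 1) * (y - x)" if "x \<le> y" for x y
    using C(2)[of x y] that by (auto simp: F_def algebra_simps abs_le_iff)
  define D where "D x y = (F y - F x) / (y - x)" for x y
  have D: "1 \<le> D x y" "D x y \<le> 2 * C + 1" if "y \<noteq> x" for x y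
    using slope[of x y] slope[of y x] that unfolding D_def
    by (cases x y rule: linorder_cases; simp add: field_simps)+
  have Dsym: "D x y = D y x" for x y
    unfolding D_def by (metis minus_diff_eq minus_divide_divide)
  have interval: "\<exists>s t. s < t \<and> s \<le> x \<and> x \<le> t \<and> t - s < d \<and> P (D s t)"
    if fr: "\<exists>\<^sub>F y in at x. P (D x y)" and "0 < d" for P x and d :: real
  proof -
    obtain y where y: "y \<noteq> x" "dist y x < d" "P (D x y)"
      using fr \<open>0 < d\<close> unfolding frequently_def eventually_at by blast
    show ?thesis
    proof (cases "x < y")
      case True
      then show ?thesis using y by (intro exI[of _ x] exI[of _ y]) (auto simp: dist_real_def)
    next
      case False
      then show ?thesis using y
        by (intro exI[of _ y] exI[of _ x]) (auto simp: dist_real_def Dsym[of y x])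
    qed
  qed
  define E where "E p q = {x. (\<exists>\<^sub>F y in at x. D x y < p) \<and> (\<exists>\<^sub>F y in at x. q < D x y)}" for p q
  have neg: "negligible (E p q \<inter> cball 0 (real n))" if "0 < p" "p < q" for p q n
  proof (rule negligible_distinct_derivates[OF slope \<open>0 < p\<close> \<open>p < q\<close>])
    show "bounded (E p q \<inter> cball 0 (real n))" by (simp add: bounded_Int)
  next
    fix x d :: real assume x: "x \<in> E p q \<inter> cball 0 (real n)" "0 < d"
    then obtain s t where "s < t \<and> s \<le> x \<and> x \<le> t \<and> t - s < d \<and> D s t < p"
      using interval[of "\<lambda>z. z < p" x d] by (auto simp: E_def)
    then show "\<exists>s t. s < t \<and> s \<le> x \<and> x \<le> t \<and> t - s < d \<and> F t - F s \<le> p * (t - s)"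
      by (intro exI[of _ s] exI[of _ t]) (auto simp: D_def field_simps)
    from x obtain s t where "s < t \<and> s \<le> x \<and> x \<le> t \<and> t - s < d \<and> q < D s t"
      using interval[of "\<lambda>z. q < z" x d] by (auto simp: E_def)
    then show "\<exists>s t. s < t \<and> s \<le> x \<and> x \<le> t \<and> t - s < d \<and> q * (t - s) \<le> F t - F s"
      by (intro exI[of _ s] exI[of _ t]) (auto simp: D_def field_simps)
  qed auto
  define R where "R = {(p, q). p \<in> \<rat> \<and> q \<in> \<rat> \<and> 0 < p \<and> p < (q :: real)}"
  have "R \<subseteq> \<rat> \<times> \<rat>" by (auto simp: R_def)
  then have "countable R"
    by (rule countable_subset) (simp add: countable_rat)
  then have "negligible (\<Union>(p, q)\<in>R. \<Union>n. E p q \<inter> cball 0 (real n))"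
    by (intro negligible_countable_Union countable_image)
      (auto simp: R_def simp del: UN_simps intro!: neg)
  then show ?thesis
  proof (rule negligible_subset, safe)
    fix x assume nd: "\<not> h differentiable (at x)"
    define a b where "a = Liminf (at x) (\<lambda>y. ereal (D x y))"
      and "b = Limsup (at x) (\<lambda>y. ereal (D x y))"
    have ev: "\<forall>\<^sub>F y in at x. y \<noteq> x" by (simp add: eventually_at_filter)
    have "ereal 1 \<le> a" unfolding a_def
      by (rule Liminf_bounded, rule eventually_mono[OF ev]) (use D in auto)
    have "a \<le> b" unfolding a_def b_def by (rule Liminf_le_Limsup) simp
    have "b \<le> ereal (2 * C + 1)" unfolding b_def
      by (rule Limsup_bounded, rule eventually_mono[OF ev]) (use D in auto)
    obtain a' b' where ab: "a = ereal a'" "b = ereal b'"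
      using \<open>ereal 1 \<le> a\<close> \<open>a \<le> b\<close> \<open>b \<le> ereal (2 * C + 1)\<close> by (cases a; cases b) auto
    have "a \<noteq> b"
    proof
      assume "a = b"
      then have "((\<lambda>y. ereal (D x y)) \<longlongrightarrow> ereal a') (at x)"
        by (intro Liminf_eq_Limsup) (use ab in \<open>auto simp: a_def b_def\<close>)
      then have "(F has_real_derivative a') (at x)"
        by (simp add: has_field_derivative_iff D_def)
      then have "((\<lambda>y. F y - (C + 1) * y) has_real_derivative a' - (C + 1)) (at x)"
        by (auto intro!: derivative_eq_intros)
      moreover have "(\<lambda>y. F y - (C + 1) * y) = h" by (auto simp: F_def)
      ultimately show False
        using nd real_differentiable_def by metis
    qed
    then have "a' < b'" using \<open>a \<le> b\<close> ab by auto
    obtain p where p: "p \<in> \<rat>" "a' < p" "p < b'" using Rats_dense_in_real[OF \<open>a' < b'\<close>] by auto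
    obtain q where q: "q \<in> \<rat>" "p < q" "q < b'" using Rats_dense_in_real[OF \<open>p < b'\<close>] by auto
    have "0 < p" using \<open>ereal 1 \<le> a\<close> ab p by auto
    have "\<exists>\<^sub>F y in at x. D x y < p"
    proof (rule ccontr)
      assume "\<not> ?thesis"
      then have "ereal p \<le> a" unfolding a_def frequently_def
        by (intro Liminf_bounded) (auto simp: not_less)
      then show False using ab p by auto
    qed
    moreover have "\<exists>\<^sub>F y in at x. q < D x y"
    proof (rule ccontr)
      assume "\<not> ?thesis"
      then have "b \<le> ereal q" unfolding b_def frequently_def
        by (intro Limsup_bounded) (auto simp: not_less)
      then show False using ab q by auto
    qed
    ultimately have "x \<in> E p q" by (simp add: E_def)
    moreover obtain n where "norm x \<le> real n" using real_arch_simple by blast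
    ultimately have "x \<in> (\<Union>n. E p q \<inter> cball 0 (real n))" by auto
    moreover have "(p, q) \<in> R" using p q \<open>0 < p\<close> by (auto simp: R_def)
    ultimately show "x \<in> (\<Union>(p, q)\<in>R. \<Union>n. E p q \<inter> cball 0 (real n))" by blast
  qed
qed

text \<open>
  A mean value inequality with an exceptional null set.  Intervals of slope at most \<open>c + e\<close> cover the
  points outside \<open>N\<close> up to a null set, and the Stieltjes measure of \<open>F\<close> ignores null sets, so the whole
  increment of \<open>F\<close> is carried by these intervals.
\<close>
lemma bilipschitz_increment_le_derivative_bound:
  fixes F :: "real \<Rightarrow> real"
  assumes slope: "\<And>x y. x \<le> y \<Longrightarrow> y - x \<le> F y - F x \<and> F y - F x \<le> D * (y - x)"
    and "0 \<le> c" and N: "negligible N"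
    and deriv: "\<And>x. x \<notin> N \<Longrightarrow> \<exists>d\<le>c. (F has_real_derivative d) (at x)"
    and "x \<le> y"
  shows "F y - F x \<le> c * (y - x)"
proof (rule field_le_epsilon)
  fix e' :: real assume "0 < e'"
  \<comment> \<open>the summand \<open>1\<close> keeps the denominator positive for \<open>x = y\<close>\<close>
  define e where "e = e' / (y - x + 1)"
  have "0 < e" using \<open>0 < e'\<close> \<open>x \<le> y\<close> by (simp add: e_def)
  obtain \<nu> :: "real measure" where \<nu>: "sets \<nu> = sets borel"
    "\<And>s t. s \<le> t \<Longrightarrow> emeasure \<nu> {s<..<t} = ennreal (F t - F s)"
    "\<And>N. negligible N \<Longrightarrow> N \<in> sets borel \<Longrightarrow> emeasure \<nu> N = 0"
    by (rule stieltjes_measure_of_bilipschitz[OF slope]) (assumption | rule that)+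
  have fine: "\<exists>s t. s < t \<and> s \<le> z \<and> z \<le> t \<and> t - s < r \<and> F t - F s \<le> (c + e) * (t - s)"
    if "z \<in> {x<..<y} - N" "0 < r" for z r
  proof -
    obtain d where d: "d \<le> c" "(F has_real_derivative d) (at z)" using deriv \<open>z \<in> {x<..<y} - N\<close> by auto
    have "((\<lambda>t. (F t - F z) / (t - z)) \<longlongrightarrow> d) (at z)"
      using d(2) by (simp add: has_field_derivative_iff)
    then have "\<forall>\<^sub>F t in at z. (F t - F z) / (t - z) < c + e"
      by (rule order_tendstoD) (use d \<open>0 < e\<close> in auto)
    then obtain r' where r': "0 < r'"
      "\<And>t. t \<noteq> z \<Longrightarrow> dist t z < r' \<Longrightarrow> (F t - F z) / (t - z) < c + e"
      unfolding eventually_at by auto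
    define t where "t = z + min r r' / 2"
    have t: "z < t" "t - z < r" "dist t z < r'"
      using r'(1) \<open>0 < r\<close> by (auto simp: t_def dist_real_def)
    then have "F t - F z \<le> (c + e) * (t - z)"
      using r'(2)[of t] by (simp add: field_simps)
    then show ?thesis using t by (intro exI[of _ z] exI[of _ t]) auto
  qed
  obtain I where I: "countable I"
    "\<And>s t. (s, t) \<in> I \<Longrightarrow> s < t \<and> F t - F s \<le> (c + e) * (t - s) \<and> {s<..<t} \<subseteq> {x<..<y}"
    "disjoint_family_on (\<lambda>(s, t). {s<..<t}) I"
    "negligible ({x<..<y} - N - (\<Union>(s, t)\<in>I. {s<..<t}))"
    by (rule Vitali_covering_by_intervals[OF open_greaterThanLessThan Diff_subset fine])
      (assumption | rule that)+
  define U where "U = (\<Union>(s, t)\<in>I. {s<..<t})"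
  have U: "open U" "U \<subseteq> {x<..<y}" using I(2) unfolding U_def by fastforce+
  have "negligible ({x<..<y} - U)"
    using negligible_Un[OF I(4) N] unfolding U_def[symmetric] by (rule negligible_subset) auto
  then have null: "emeasure \<nu> ({x<..<y} - U) = 0"
    by (rule \<nu>(3)) (use U in auto)
  have "ennreal (F y - F x) = emeasure \<nu> {x<..<y}" using \<open>x \<le> y\<close> \<nu> by simp
  also have "\<dots> \<le> emeasure \<nu> U + emeasure \<nu> ({x<..<y} - U)"
    using U \<nu>(1) by (subst plus_emeasure) (auto simp: Un_absorb1)
  also have "\<dots> = emeasure \<nu> U" by (simp add: null)
  also have "\<dots> \<le> ennreal (c + e) * emeasure lborel U"
    unfolding U_def
  proof (rule emeasure_disjoint_UN_le)
    fix i assume "i \<in> I"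
    then show "emeasure \<nu> (case i of (s, t) \<Rightarrow> {s<..<t})
        \<le> ennreal (c + e) * emeasure lborel (case i of (s, t) \<Rightarrow> {s<..<t})"
      using I(2)[of "fst i" "snd i"] \<open>0 \<le> c\<close> \<open>0 < e\<close>
      by (auto simp: \<nu> ennreal_mult'[symmetric] split_beta simp del: ennreal_plus intro!: ennreal_leI)
  qed (use I \<nu> in auto)
  also have "emeasure lborel U \<le> emeasure lborel {x<..<y}"
    using U by (intro emeasure_mono) auto
  also have "ennreal (c + e) * emeasure lborel {x<..<y} = ennreal ((c + e) * (y - x))"
    using \<open>x \<le> y\<close> \<open>0 \<le> c\<close> \<open>0 < e\<close> by (simp add: ennreal_mult')
  finally have "ennreal (F y - F x) \<le> ennreal ((c + e) * (y - x))"
    by (auto simp: mult_left_mono)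
  then have "F y - F x \<le> (c + e) * (y - x)"
    using \<open>x \<le> y\<close> \<open>0 \<le> c\<close> \<open>0 < e\<close> by (subst (asm) ennreal_le_iff) auto
  also have "\<dots> \<le> c * (y - x) + e'"
    using \<open>x \<le> y\<close> \<open>0 < e'\<close> by (simp add: e_def field_simps)
  finally show "F y - F x \<le> c * (y - x) + e'" .
qed

text \<open>
  Where \<open>h\<close> is not differentiable, \<open>deriv h\<close> is an arbitrary value, so that
  differentiability almost everywhere is needed before the bound says anything about \<open>h\<close>.  The two
  inequalities in the Lipschitz condition are the mean value inequality for \<open>h\<close> and for \<open>- h\<close>, tilted by
  a linear function to make them increasing.
\<close>
lemma lipschitz_on_deriv_bound_AE:
  fixes h :: "real \<Rightarrow> real"
  assumes "C-lipschitz_on UNIV h" "AE x in lebesgue. \<bar>deriv h x\<bar> \<le> K"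
  shows "K-lipschitz_on UNIV h"
proof -
  have C: "0 \<le> C" "\<bar>h x - h y\<bar> \<le> C * \<bar>x - y\<bar>" for x y
    using assms by (auto simp: lipschitz_on_def dist_real_def)
  obtain N where N: "{x. \<not> \<bar>deriv h x\<bar> \<le> K} \<subseteq> N" "negligible N"
    using assms(2) by (auto simp: eventually_ae_filter negligible_iff_null_sets)
  define N' where "N' = N \<union> {x. \<not> h differentiable (at x)}"
  have N': "negligible N'"
    unfolding N'_def using N(2) lipschitz_imp_differentiable_AE[OF assms(1)] by (rule negligible_Un)
  have "N' \<noteq> UNIV" using N' by auto
  then obtain x where "x \<notin> N'" by blast
  then have "\<bar>deriv h x\<bar> \<le> K" using N(1) by (auto simp: N'_def)
  then have "0 \<le> K" by linarith
  have *: "h' y - h' x \<le> K * (y - x)"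
    if "x \<le> y" and lip: "\<And>x y. \<bar>h' x - h' y\<bar> \<le> C * \<bar>x - y\<bar>"
      and der: "\<And>x. x \<notin> N' \<Longrightarrow> \<exists>d\<le>K. (h' has_real_derivative d) (at x)" for h' x y
  proof -
    have "(h' y + (C + 1) * y) - (h' x + (C + 1) * x) \<le> (K + (C + 1)) * (y - x)"
    proof (rule bilipschitz_increment_le_derivative_bound[where D = "2 * C + 1" and N = N'])
      fix x y :: real assume "x \<le> y"
      then show "y - x \<le> (h' y + (C + 1) * y) - (h' x + (C + 1) * x) \<and>
          (h' y + (C + 1) * y) - (h' x + (C + 1) * x) \<le> (2 * C + 1) * (y - x)"
        using lip[of x y] by (auto simp: algebra_simps abs_le_iff)
    next
      fix x assume "x \<notin> N'"
      then obtain d where "d \<le> K" "(h' has_real_derivative d) (at x)" using der by blast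
      then show "\<exists>d\<le>K + (C + 1). ((\<lambda>y. h' y + (C + 1) * y) has_real_derivative d) (at x)"
        by (intro exI[of _ "d + (C + 1)"]) (auto intro!: derivative_eq_intros)
    qed (use N' C \<open>0 \<le> K\<close> \<open>x \<le> y\<close> in auto)
    then show ?thesis by (simp add: algebra_simps)
  qed
  have d: "(h has_real_derivative deriv h x) (at x)" "\<bar>deriv h x\<bar> \<le> K" if "x \<notin> N'" for x
    using that N(1) by (auto simp: N'_def DERIV_deriv_iff_real_differentiable)
  have "\<bar>h y - h x\<bar> \<le> K * (y - x)" if "x \<le> y" for x y
  proof -
    have "h y - h x \<le> K * (y - x)"
      by (rule *[OF that C(2)]) (use d in \<open>auto simp: abs_le_iff\<close>)
    moreover have "- h y - - h x \<le> K * (y - x)"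
    proof (rule *[OF that])
      show "\<bar>- h x - - h y\<bar> \<le> C * \<bar>x - y\<bar>" for x y using C(2)[of x y] by auto
      show "\<exists>d\<le>K. ((\<lambda>x. - h x) has_real_derivative d) (at x)" if "x \<notin> N'" for x
        using d[OF that] by (intro exI[of _ "- deriv h x"]) (auto intro!: derivative_eq_intros)
    qed
    ultimately show ?thesis by auto
  qed
  then have "\<bar>h x - h y\<bar> \<le> K * \<bar>x - y\<bar>" for x y
    by (cases x y rule: le_cases) (fastforce simp: abs_minus_commute)+
  then show ?thesis
    using \<open>0 \<le> K\<close> by (auto simp: lipschitz_on_def dist_real_def)
qed

lemma lipschitz_on_deriv_esssup:
  assumes "C-lipschitz_on UNIV h" "deriv_esssup h < \<infinity>"
  obtains K where "deriv_esssup h = ereal K" "K-lipschitz_on UNIV h"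
proof -
  have AE: "AE x in lebesgue. ereal \<bar>deriv h x\<bar> \<le> deriv_esssup h"
    unfolding deriv_esssup_def by (rule esssup_AE)
  have "deriv_esssup h \<noteq> - \<infinity>"
  proof
    assume "deriv_esssup h = - \<infinity>"
    with AE have "ae_filter lebesgue = (bot :: real filter)"
      by (simp add: trivial_limit_def)
    then show False by (simp add: ae_filter_eq_bot_iff)
  qed
  then obtain K where K: "deriv_esssup h = ereal K"
    using assms(2) by (cases "deriv_esssup h") auto
  then have "K-lipschitz_on UNIV h"
    using AE by (intro lipschitz_on_deriv_bound_AE[OF assms(1)]) simp
  with K show thesis by (rule that)
qed

section \<open>Estimates near one end of the interval\<close>

lemma eventually_to_upperD:
  assumes "eventually P (to_upper u)" "ereal a < u"
  obtains b where "a \<le> b" "ereal b < u" "\<And>x. b \<le> x \<Longrightarrow> ereal x < u \<Longrightarrow> P x"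
proof (cases u)
  case (real v)
  then obtain b where b: "b < v" "\<And>y. b < y \<Longrightarrow> y < v \<Longrightarrow> P y"
    using assms eventually_at_left[of a v P] by (auto simp: to_upper_def)
  define m where "m = max a b"
  have "m < v" using b assms real by (simp add: m_def)
  show thesis
    by (rule that[of "(m + v) / 2"]) (use b \<open>m < v\<close> real in \<open>auto simp: m_def field_simps\<close>)
next
  case PInf
  then obtain b where b: "\<And>y. b \<le> y \<Longrightarrow> P y"
    using assms by (auto simp: to_upper_def eventually_at_top_linorder)
  show thesis
    by (rule that[of "max a b"]) (use b PInf in \<open>auto simp flip: ereal_max\<close>)
next
  case MInf
  then show thesis using assms by simp
qed

lemma to_lower_eq_filtermap_to_upper:
  assumes "l \<noteq> \<infinity>"
  shows "to_lower l = filtermap uminus (to_upper (- l))"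
  using assms
  by (cases l) (auto simp: to_lower_def to_upper_def at_bot_mirror at_right_minus)

text \<open>
  If the limit \<open>d\<close> of \<open>G'\<close> is positive, and infinite in case \<open>u = \<infinity>\<close>, then \<open>G'\<close> is bounded below
  by a positive constant and \<open>G\<close> dominates a positive multiple of \<open>x\<close>.  Otherwise \<open>G'\<close> stays strictly below
  \<open>c * x\<close> near \<open>u\<close>: for \<open>u = \<infinity>\<close> because it is bounded above, and for finite \<open>u\<close> because its
  limit is not positive.
\<close>
lemma positive_slope_dichotomy:
  fixes G G' :: "real \<Rightarrow> real"
  assumes "0 < a" "ereal a < u" "0 < c"
    and der: "\<And>x. a \<le> x \<Longrightarrow> ereal x < u \<Longrightarrow> (G has_real_derivative G' x) (at x)"
    and pos: "\<And>x. a \<le> x \<Longrightarrow> ereal x < u \<Longrightarrow> 0 < G x"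
    and lim: "((\<lambda>x. ereal (G' x)) \<longlongrightarrow> d) (to_upper u)"
  obtains
    (linear) b \<kappa> where "a \<le> b" "ereal b < u" "0 < \<kappa>"
      "\<And>x. b \<le> x \<Longrightarrow> ereal x < u \<Longrightarrow> \<kappa> * x \<le> G x"
  | (slow) b \<eta> where "a \<le> b" "ereal b < u" "0 < \<eta>"
      "\<And>x. b \<le> x \<Longrightarrow> ereal x < u \<Longrightarrow> G' x + \<eta> \<le> c * x"
proof (cases "0 < d \<and> (u = \<infinity> \<longrightarrow> d = \<infinity>)")
  case True
  then obtain \<kappa> where \<kappa>: "0 < \<kappa>" "ereal \<kappa> < d"
    using ereal_dense2[of 0 d] by auto
  have "eventually (\<lambda>x. ereal \<kappa> < ereal (G' x)) (to_upper u)"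
    using lim \<kappa>(2) by (rule order_tendstoD)
  then obtain b where b: "a \<le> b" "ereal b < u" "\<And>x. b \<le> x \<Longrightarrow> ereal x < u \<Longrightarrow> ereal \<kappa> < ereal (G' x)"
    using \<open>ereal a < u\<close> by (rule eventually_to_upperD) (rule that)
  \<comment> \<open>the line with slope \<open>\<mu>\<close> through the origin lies below \<open>G\<close> at \<open>b\<close> and grows no faster than \<open>G\<close> afterwards\<close>
  define \<mu> where "\<mu> = min \<kappa> (G b / b)"
  have "0 < b" using b(1) \<open>0 < a\<close> by linarith
  then have \<mu>: "0 < \<mu>" "\<mu> \<le> \<kappa>" "\<mu> * b \<le> G b"
    using pos[OF b(1,2)] \<kappa> by (auto simp: \<mu>_def min_def field_simps)
  show thesis
  proof (rule linear[OF b(1,2) \<mu>(1)])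
    fix x assume x: "b \<le> x" "ereal x < u"
    have "G b - \<mu> * b \<le> G x - \<mu> * x"
    proof (rule DERIV_nonneg_imp_nondecreasing[OF x(1)])
      fix z assume z: "b \<le> z" "z \<le> x"
      then have zu: "ereal z < u" using x(2) by (meson ereal_less_eq(3) le_less_trans)
      have "((\<lambda>x. G x - \<mu> * x) has_real_derivative G' z - \<mu>) (at z)"
        using der[of z] z b(1) zu by (auto intro!: derivative_eq_intros)
      moreover have "0 \<le> G' z - \<mu>" using b(3)[OF z(1) zu] \<mu>(2) by simp
      ultimately show "\<exists>y. ((\<lambda>x. G x - \<mu> * x) has_real_derivative y) (at z) \<and> 0 \<le> y" by blast
    qed
    then show "\<mu> * x \<le> G x" using \<mu>(3) by linarith
  qed
next
  case False
  obtain \<beta> b0 :: real where \<beta>: "d < ereal \<beta>" "a \<le> b0" "ereal b0 < u" "\<beta> < c * b0"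
  proof (cases "u = \<infinity>")
    case True
    with False have "d < \<infinity>" by auto
    then obtain \<beta> where "d < ereal \<beta>" by (metis ereal_dense2)
    then show thesis
      using True \<open>0 < c\<close> by (intro that[of \<beta> "max a ((\<beta> + 1) / c)"]) (auto simp: field_simps max_def)
  next
    case u: False
    with False have "d \<le> 0" by auto
    show thesis
      by (rule that[of "c * a / 2" a]) (use \<open>d \<le> 0\<close> \<open>0 < c\<close> \<open>0 < a\<close> \<open>ereal a < u\<close> in \<open>auto intro: le_less_trans\<close>)
  qed
  have "eventually (\<lambda>x. ereal (G' x) < ereal \<beta>) (to_upper u)"
    using lim \<beta>(1) by (rule order_tendstoD)
  then obtain b where b: "b0 \<le> b" "ereal b < u" "\<And>x. b \<le> x \<Longrightarrow> ereal x < u \<Longrightarrow> ereal (G' x) < ereal \<beta>"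
    using \<beta>(3) by (rule eventually_to_upperD) (rule that)
  show thesis
  proof (rule slow[of b "c * b0 - \<beta>"])
    fix x assume x: "b \<le> x" "ereal x < u"
    have "c * b0 \<le> c * x" using b(1) x \<open>0 < c\<close> by simp
    then show "G' x + (c * b0 - \<beta>) \<le> c * x" using b(3)[OF x] by simp
  qed (use b \<beta> in auto)
qed

text \<open>
  With \<open>T\<close> the tail of the law and \<open>\<phi> = g * \<rho>\<close>, the quantity \<open>\<phi> x - x * T x\<close> is the integral of \<open>T\<close>
  over \<open>(x, u)\<close>.  In the linear case of \<open>positive_slope_dichotomy\<close> the factor \<open>x\<close> is itself bounded by a
  multiple of \<open>g x\<close>.  In the slow case compare \<open>\<phi> / x - T\<close>, which has derivative \<open>- \<phi> / x\<^sup>2\<close> and is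
  small near \<open>u\<close>, with \<open>\<phi> * G / (\<eta> * x\<^sup>2)\<close>, whose derivative is
  \<open>- (\<phi> / (\<eta> * x\<^sup>2)) * (x * G / g - G' + 2 * G / x)\<close>.  The bracket is at least \<open>\<eta>\<close>, so the difference \<open>R\<close>
  increases; as it is at most \<open>\<phi> / x\<close>, which takes arbitrarily small values near \<open>u\<close>, it is never
  positive.
\<close>
lemma tail_estimate:
  fixes \<phi> T \<rho> g G G' :: "real \<Rightarrow> real"
  assumes "0 < a" "ereal a < u" "0 < \<alpha>" "0 < \<gamma>"
    and \<phi>': "\<And>x. a \<le> x \<Longrightarrow> ereal x < u \<Longrightarrow> (\<phi> has_real_derivative - (x * \<rho> x)) (at x)"
    and T': "\<And>x. a \<le> x \<Longrightarrow> ereal x < u \<Longrightarrow> (T has_real_derivative - \<rho> x) (at x)"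
    and G': "\<And>x. a \<le> x \<Longrightarrow> ereal x < u \<Longrightarrow> (G has_real_derivative G' x) (at x)"
    and \<rho>: "\<And>x. a \<le> x \<Longrightarrow> ereal x < u \<Longrightarrow> 0 < \<rho> x"
    and T: "\<And>x. a \<le> x \<Longrightarrow> ereal x < u \<Longrightarrow> 0 \<le> T x"
    and G: "\<And>x. a \<le> x \<Longrightarrow> ereal x < u \<Longrightarrow> 0 < G x"
    and \<phi>: "\<And>x. a \<le> x \<Longrightarrow> ereal x < u \<Longrightarrow> \<phi> x = g x * \<rho> x"
    and gG: "\<And>x. a \<le> x \<Longrightarrow> ereal x < u \<Longrightarrow> \<alpha> * G x \<le> g x \<and> g x \<le> \<gamma> * G x"
    and lim: "((\<lambda>x. ereal (G' x)) \<longlongrightarrow> d) (to_upper u)"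
    and vanish: "\<And>x e. a \<le> x \<Longrightarrow> ereal x < u \<Longrightarrow> 0 < e \<Longrightarrow> \<exists>b. x \<le> b \<and> ereal b < u \<and> \<phi> b < e"
  obtains b C where "a \<le> b" "ereal b < u"
    "\<And>x. b \<le> x \<Longrightarrow> ereal x < u \<Longrightarrow> x * (\<phi> x - x * T x) \<le> C * (\<phi> x * g x)"
proof -
  have gpos: "0 < g x" if "a \<le> x" "ereal x < u" for x
    using gG[OF that] G[OF that] \<open>0 < \<alpha>\<close> by (smt (verit) mult_pos_pos)
  have \<phi>pos: "0 < \<phi> x" if "a \<le> x" "ereal x < u" for x
    using gpos[OF that] \<rho>[OF that] \<phi>[OF that] by simp
  have "0 < 1 / \<gamma>" using \<open>0 < \<gamma>\<close> by simp
  then show thesis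
  proof (rule positive_slope_dichotomy[OF \<open>0 < a\<close> \<open>ereal a < u\<close> _ G' G lim])
    fix b \<kappa> assume b: "a \<le> b" "ereal b < u" and "0 < \<kappa>"
      and lin: "\<And>x. b \<le> x \<Longrightarrow> ereal x < u \<Longrightarrow> \<kappa> * x \<le> G x"
    show thesis
    proof (rule that[OF b])
      fix x assume x: "b \<le> x" "ereal x < u"
      then have ax: "a \<le> x" using b by simp
      have "\<alpha> * (\<kappa> * x) \<le> \<alpha> * G x" using lin[OF x] \<open>0 < \<alpha>\<close> by simp
      also have "\<dots> \<le> g x" using gG[OF ax x(2)] by simp
      finally have xg: "x \<le> 1 / (\<alpha> * \<kappa>) * g x"
        using \<open>0 < \<alpha>\<close> \<open>0 < \<kappa>\<close> by (simp add: field_simps)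
      have "x * (\<phi> x - x * T x) \<le> x * \<phi> x"
        using T[OF ax x(2)] \<open>0 < a\<close> ax by (intro mult_left_mono) auto
      also have "\<dots> \<le> 1 / (\<alpha> * \<kappa>) * g x * \<phi> x"
        using xg \<phi>pos[OF ax x(2)] by (intro mult_right_mono) auto
      finally show "x * (\<phi> x - x * T x) \<le> 1 / (\<alpha> * \<kappa>) * (\<phi> x * g x)"
        by (simp add: mult_ac)
    qed
  next
    fix b \<eta> assume b: "a \<le> b" "ereal b < u" and "0 < \<eta>"
      and slow: "\<And>x. b \<le> x \<Longrightarrow> ereal x < u \<Longrightarrow> G' x + \<eta> \<le> 1 / \<gamma> * x"
    define R where "R x = \<phi> x / x - T x - \<phi> x * G x / (\<eta> * x\<^sup>2)" for x
    define R' where "R' x = \<phi> x / (\<eta> * x\<^sup>2) * (x * G x / g x - G' x - \<eta> + 2 * G x / x)" for x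
    have R': "(R has_real_derivative R' x) (at x)" if "b \<le> x" "ereal x < u" for x
    proof -
      have x: "a \<le> x" "0 < x" using that b \<open>0 < a\<close> by auto
      have e: "\<rho> x = \<phi> x / g x" using \<phi>[OF x(1) that(2)] gpos[OF x(1) that(2)] by simp
      have "(R has_real_derivative
          ((- (x * \<rho> x)) * x - \<phi> x) / (x * x) - (- \<rho> x)
          - ((- (x * \<rho> x) * G x + G' x * \<phi> x) * (\<eta> * x\<^sup>2) - \<phi> x * G x * (\<eta> * (2 * x))) / ((\<eta> * x\<^sup>2) * (\<eta> * x\<^sup>2))) (at x)"
        unfolding R_def using x \<open>0 < \<eta>\<close>
        by (auto intro!: derivative_eq_intros \<phi>'[OF x(1) that(2)] T'[OF x(1) that(2)] G'[OF x(1) that(2)])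
      also have "((- (x * \<rho> x)) * x - \<phi> x) / (x * x) - (- \<rho> x)
          - ((- (x * \<rho> x) * G x + G' x * \<phi> x) * (\<eta> * x\<^sup>2) - \<phi> x * G x * (\<eta> * (2 * x))) / ((\<eta> * x\<^sup>2) * (\<eta> * x\<^sup>2)) = R' x"
        unfolding R'_def e using x \<open>0 < \<eta>\<close> gpos[OF x(1) that(2)]
        by (simp add: field_simps power2_eq_square)
      finally show ?thesis .
    qed
    have R'_nonneg: "0 \<le> R' x" if "b \<le> x" "ereal x < u" for x
    proof -
      have x: "a \<le> x" "0 < x" using that b \<open>0 < a\<close> by auto
      note pos = \<phi>pos[OF x(1) that(2)] gpos[OF x(1) that(2)] G[OF x(1) that(2)]
      have "1 / \<gamma> \<le> G x / g x"
        using gG[OF x(1) that(2)] pos \<open>0 < \<gamma>\<close> by (simp add: field_simps)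
      then have "1 / \<gamma> * x \<le> G x / g x * x"
        using x by (intro mult_right_mono) auto
      then have "0 \<le> x * G x / g x - G' x - \<eta> + 2 * G x / x"
        using slow[OF that] pos x by (simp add: mult.commute)
      then show ?thesis
        unfolding R'_def using pos x \<open>0 < \<eta>\<close> by (intro mult_nonneg_nonneg) auto
    qed
    have R_mono: "R x \<le> R y" if "b \<le> x" "x \<le> y" "ereal y < u" for x y
    proof (rule DERIV_nonneg_imp_nondecreasing[OF that(2)])
      fix z assume "x \<le> z" "z \<le> y"
      then have "b \<le> z" "ereal z < u" using that by (auto intro: le_less_trans[of _ "ereal y"])
      then show "\<exists>y. (R has_real_derivative y) (at z) \<and> 0 \<le> y"
        using R' R'_nonneg by blast
    qed
    have R_nonpos: "R x \<le> 0" if x: "b \<le> x" "ereal x < u" for x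
    proof (rule field_le_epsilon)
      fix e :: real assume "0 < e"
      obtain y where y: "x \<le> y" "ereal y < u" "\<phi> y < a * e"
        using vanish[of x "a * e"] x b \<open>0 < a\<close> \<open>0 < e\<close> by auto
      have ay: "a \<le> y" "0 < y" using x y b \<open>0 < a\<close> by auto
      have "R x \<le> R y" using R_mono x y by blast
      also have "\<dots> \<le> \<phi> y / y"
      proof -
        have "0 \<le> \<phi> y * G y / (\<eta> * y\<^sup>2)"
          using \<phi>pos[OF ay(1) y(2)] G[OF ay(1) y(2)] \<open>0 < \<eta>\<close> by simp
        then show ?thesis unfolding R_def using T[OF ay(1) y(2)] by linarith
      qed
      also have "\<dots> \<le> \<phi> y / a"
        using ay \<open>0 < a\<close> \<phi>pos[OF ay(1) y(2)] by (intro divide_left_mono) auto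
      also have "\<dots> \<le> e" using y(3) \<open>0 < a\<close> by (simp add: field_simps)
      finally show "R x \<le> 0 + e" by simp
    qed
    show thesis
    proof (rule that[OF b])
      fix x assume x: "b \<le> x" "ereal x < u"
      have ax: "a \<le> x" "0 < x" using x b \<open>0 < a\<close> by auto
      have "x * (\<phi> x - x * T x) = x\<^sup>2 * (R x + \<phi> x * G x / (\<eta> * x\<^sup>2))"
        unfolding R_def using ax by (simp add: field_simps power2_eq_square)
      also have "\<dots> \<le> x\<^sup>2 * (\<phi> x * G x / (\<eta> * x\<^sup>2))"
        using R_nonpos[OF x] by (intro mult_left_mono) auto
      also have "\<dots> = \<phi> x * (\<alpha> * G x) / (\<alpha> * \<eta>)"
        using ax \<open>0 < \<alpha>\<close> by simp
      also have "\<dots> \<le> \<phi> x * g x / (\<alpha> * \<eta>)"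
        using gG[OF ax(1) x(2)] \<phi>pos[OF ax(1) x(2)] \<open>0 < \<alpha>\<close> \<open>0 < \<eta>\<close>
        by (intro divide_right_mono mult_left_mono) auto
      finally show "x * (\<phi> x - x * T x) \<le> 1 / (\<alpha> * \<eta>) * (\<phi> x * g x)" by simp
    qed
  qed
qed

text \<open>
  Since \<open>V x \<le> 1\<close>, the second factor is at most \<open>\<phi> x + x\<close>, and \<open>\<phi> x\<close> is at most a constant multiple
  of \<open>x\<close> because \<open>\<phi>\<close> decreases on the positive axis.  This leaves \<open>x * (\<phi> x - x * T x)\<close>, which is
  \<open>tail_estimate\<close>.  The functions are abstract here so that the lemma also serves the lower
  end: reflection at the origin exchanges \<open>T\<close> and \<open>V\<close>.
\<close>
lemma product_estimate_at_upper_end: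
  fixes \<phi> T V \<rho> g G G' :: "real \<Rightarrow> real"
  assumes "0 < u"
    and \<phi>': "\<And>x. 0 < x \<Longrightarrow> ereal x < u \<Longrightarrow> (\<phi> has_real_derivative - (x * \<rho> x)) (at x)"
    and T': "\<And>x. 0 < x \<Longrightarrow> ereal x < u \<Longrightarrow> (T has_real_derivative - \<rho> x) (at x)"
    and G': "\<And>x. 0 < x \<Longrightarrow> ereal x < u \<Longrightarrow> (G has_real_derivative G' x) (at x)"
    and \<rho>: "\<And>x. 0 < x \<Longrightarrow> ereal x < u \<Longrightarrow> 0 < \<rho> x"
    and T: "\<And>x. 0 < x \<Longrightarrow> ereal x < u \<Longrightarrow> 0 \<le> T x"
    and V: "\<And>x. 0 < x \<Longrightarrow> ereal x < u \<Longrightarrow> V x \<le> 1"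
    and A: "\<And>x. 0 < x \<Longrightarrow> ereal x < u \<Longrightarrow> 0 \<le> \<phi> x - x * T x"
    and G: "\<And>x. 0 < x \<Longrightarrow> ereal x < u \<Longrightarrow> 0 < G x"
    and g: "\<And>x. 0 < x \<Longrightarrow> ereal x < u \<Longrightarrow> 0 < g x"
    and \<phi>: "\<And>x. 0 < x \<Longrightarrow> ereal x < u \<Longrightarrow> \<phi> x = g x * \<rho> x"
    and gG: "\<forall>\<^sub>F x in to_upper u. \<alpha> \<le> g x / G x" "0 < \<alpha>" "\<forall>\<^sub>F x in to_upper u. g x / G x \<le> \<gamma>"
    and lim: "((\<lambda>x. ereal (G' x)) \<longlongrightarrow> d) (to_upper u)"
    and vanish: "\<And>x e. 0 < x \<Longrightarrow> ereal x < u \<Longrightarrow> 0 < e \<Longrightarrow> \<exists>b. x \<le> b \<and> ereal b < u \<and> \<phi> b < e"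
  obtains b k where "0 < b" "ereal b < u"
    "\<And>x. b \<le> x \<Longrightarrow> ereal x < u \<Longrightarrow> (\<phi> x - x * T x) * (\<phi> x + x * V x) \<le> k * (\<phi> x * g x)"
proof -
  obtain a0 where "0 < a0" "ereal a0 < u"
    using ereal_dense2[OF \<open>0 < u\<close>] by auto
  have "\<forall>\<^sub>F x in to_upper u. \<alpha> \<le> g x / G x \<and> g x / G x \<le> \<gamma>"
    using gG by (simp add: eventually_conj_iff)
  then obtain a where "a0 \<le> a" "ereal a < u" and
      ga: "\<And>x. a \<le> x \<Longrightarrow> ereal x < u \<Longrightarrow> \<alpha> \<le> g x / G x \<and> g x / G x \<le> \<gamma>"
    using \<open>ereal a0 < u\<close> by (rule eventually_to_upperD) (rule that)
  have a: "0 < a" using \<open>0 < a0\<close> \<open>a0 \<le> a\<close> by simp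
  have "0 < \<gamma>" using ga[of a] \<open>ereal a < u\<close> gG(2) by auto
  have ga': "\<alpha> * G x \<le> g x \<and> g x \<le> \<gamma> * G x" if "a \<le> x" "ereal x < u" for x
    using ga[OF that] G[of x] that a by (auto simp: field_simps)
  show thesis
  proof (rule tail_estimate[where a = a and u = u and \<alpha> = \<alpha> and \<gamma> = \<gamma> and \<phi> = \<phi> and T = T
        and \<rho> = \<rho> and g = g and G = G and G' = G' and d = d])
    fix b C assume b: "a \<le> b" "ereal b < u"
      and C: "\<And>x. b \<le> x \<Longrightarrow> ereal x < u \<Longrightarrow> x * (\<phi> x - x * T x) \<le> C * (\<phi> x * g x)"
    have "0 < b" using a b by simp
    show thesis
    proof (rule that[OF \<open>0 < b\<close> b(2)])
      fix x assume x: "b \<le> x" "ereal x < u"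
      have x0: "0 < x" using \<open>0 < b\<close> x by simp
      have "\<phi> x \<le> \<phi> b"
      proof (rule DERIV_nonpos_imp_nonincreasing[OF x(1)])
        fix z assume z: "b \<le> z" "z \<le> x"
        then have z: "0 < z" "ereal z < u" using \<open>0 < b\<close> x by (auto intro: le_less_trans[of _ "ereal x"])
        show "\<exists>y. (\<phi> has_real_derivative y) (at z) \<and> y \<le> 0"
          using \<phi>'[OF z] \<rho>[OF z] z by (intro exI[of _ "- (z * \<rho> z)"]) (auto intro: mult_nonneg_nonneg)
      qed
      have \<phi>x: "0 < \<phi> x" using \<phi>[OF x0 x(2)] g[OF x0 x(2)] \<rho>[OF x0 x(2)] by simp
      let ?A = "\<phi> x - x * T x"
      have A0: "0 \<le> ?A" by (rule A[OF x0 x(2)])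
      have "?A * (\<phi> x + x * V x) \<le> ?A * (\<phi> x + x)"
        using A0 V[OF x0 x(2)] x0 by (intro mult_left_mono) auto
      also have "\<dots> = (x * ?A) * (\<phi> x / x + 1)"
        using x0 by (simp add: field_simps)
      also have "\<dots> \<le> (x * ?A) * (\<phi> b / b + 1)"
        using \<open>\<phi> x \<le> \<phi> b\<close> \<phi>x x x0 \<open>0 < b\<close> A0 by (intro mult_left_mono add_right_mono frac_le) auto
      also have "\<dots> \<le> (C * (\<phi> x * g x)) * (\<phi> b / b + 1)"
        using C[OF x] \<open>\<phi> x \<le> \<phi> b\<close> \<phi>x \<open>0 < b\<close> by (intro mult_right_mono) auto
      finally show "?A * (\<phi> x + x * V x) \<le> C * (\<phi> b / b + 1) * (\<phi> x * g x)"
        by (simp add: mult_ac)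
    qed
  qed (use a \<open>ereal a < u\<close> gG(2) \<open>0 < \<gamma>\<close> lim ga' in \<open>auto intro: \<phi>' T' G' \<rho> T G \<phi> vanish\<close>)
qed

section \<open>Integrals over intervals with variable endpoints\<close>

lemma set_integrable_einterval_subset:
  fixes q :: "real \<Rightarrow> real"
  assumes "set_integrable lborel (einterval l u) q" "l \<le> a" "b \<le> u"
  shows "set_integrable lborel (einterval a b) q"
  by (rule set_integrable_subset[OF assms(1)])
    (use assms(2,3) in \<open>auto simp: einterval_iff intro: le_less_trans less_le_trans\<close>)

text \<open>
  Additivity at a point, for a function that is integrable over one large interval; this avoids
  integrability side conditions with \<open>min\<close> and \<open>max\<close> of the endpoints.
\<close>
lemma interval_integral_split:
  fixes q :: "real \<Rightarrow> real"
  assumes "set_integrable lborel (einterval l u) q" "l \<le> a" "a \<le> b" "b \<le> c" "c \<le> u"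
  shows "(LBINT y=a..b. q y) + (LBINT y=b..c. q y) = (LBINT y=a..c. q y)"
proof (rule interval_integral_sum)
  have "min a (min b c) = a" "max a (max b c) = c" "a \<le> c"
    using assms by (auto simp: min_def max_def)
  then show "interval_lebesgue_integrable lborel (min a (min b c)) (max a (max b c)) q"
    using set_integrable_einterval_subset[OF assms(1), of a c] assms
    by (simp add: interval_lebesgue_integrable_def)
qed

lemma interval_integral_lower_has_derivative:
  fixes q :: "real \<Rightarrow> real"
  assumes int: "set_integrable lborel (einterval l u) q" and cont: "continuous_on (einterval l u) q"
    and x: "x \<in> einterval l u"
  shows "((\<lambda>x. LBINT y=l..ereal x. q y) has_real_derivative q x) (at x)"
proof -
  obtain c where c: "l < ereal c" "c < x"
    using x ereal_dense2[of l x] by (auto simp: einterval_iff)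
  obtain b where b: "x < b" "ereal b < u"
    using x ereal_dense2[of x u] by (auto simp: einterval_iff)
  have sub: "{c..b} \<subseteq> einterval l u"
  proof
    fix y assume "y \<in> {c..b}"
    then have "ereal c \<le> ereal y" "ereal y \<le> ereal b" by auto
    then show "y \<in> einterval l u"
      using c b unfolding einterval_iff by (meson less_le_trans le_less_trans)
  qed
  have "((\<lambda>z. LBINT y=c..z. q y) has_vector_derivative q x) (at x within {c..b})"
    by (rule interval_integral_FTC2) (use c b in \<open>auto intro: continuous_on_subset[OF cont sub]\<close>)
  then have "((\<lambda>z. LBINT y=c..z. q y) has_real_derivative q x) (at x within {c<..<b})"
    unfolding has_real_derivative_iff_has_vector_derivative
    by (rule has_vector_derivative_within_subset) auto
  then have "((\<lambda>z. LBINT y=c..z. q y) has_real_derivative q x) (at x)"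
    using c b by (subst (asm) at_within_open) auto
  then have "((\<lambda>z. (LBINT y=l..c. q y) + (LBINT y=c..z. q y)) has_real_derivative q x) (at x)"
    by (auto intro!: derivative_eq_intros)
  then show ?thesis
  proof (rule has_field_derivative_transform_within_open)
    show "open {c<..<b}" "x \<in> {c<..<b}" using c b by auto
    fix z assume "z \<in> {c<..<b}"
    then have "ereal c \<le> ereal z" "ereal z < ereal b" by auto
    moreover from this have "ereal z \<le> u" using b by (meson less_imp_le less_trans)
    ultimately show "(LBINT y=l..c. q y) + (LBINT y=c..z. q y) = (LBINT y=l..z. q y)"
      using c by (intro interval_integral_split[OF int]) auto
  qed
qed

lemma interval_integral_upper_has_derivative:
  fixes q :: "real \<Rightarrow> real"
  assumes int: "set_integrable lborel (einterval l u) q" and cont: "continuous_on (einterval l u) q"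
    and x: "x \<in> einterval l u"
  shows "((\<lambda>x. LBINT y=ereal x..u. q y) has_real_derivative - q x) (at x)"
proof -
  have "((\<lambda>x. (LBINT y=l..u. q y) - (LBINT y=l..ereal x. q y)) has_real_derivative - q x) (at x)"
    using interval_integral_lower_has_derivative[OF int cont x] by (auto intro!: derivative_eq_intros)
  then show ?thesis
  proof (rule has_field_derivative_transform_within_open)
    show "open (einterval l u)" "x \<in> einterval l u" using x by auto
    fix z assume "z \<in> einterval l u"
    then show "(LBINT y=l..u. q y) - (LBINT y=l..ereal z. q y) = (LBINT y=ereal z..u. q y)"
      using interval_integral_split[OF int, of l z u] by (simp add: einterval_iff less_imp_le)
  qed
qed

lemma interval_integral_upper_vanishes:
  fixes q :: "real \<Rightarrow> real"
  assumes int: "set_integrable lborel (einterval l u) q" and x: "x \<in> einterval l u" and "0 < e"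
  obtains b where "x \<le> b" "ereal b < u" "\<bar>LBINT y=ereal b..u. q y\<bar> < e"
proof -
  have "ereal x < u" using x by (simp add: einterval_iff)
  then obtain X where X: "incseq X" "\<And>i. ereal x < ereal (X i)" "\<And>i. ereal (X i) < u" "X \<longlonglongrightarrow> u"
    by (rule ereal_incseq_approx) (rule that)
  have "(\<lambda>i. \<integral>y. indicator (einterval (X i) u) y *\<^sub>R q y \<partial>lborel) \<longlonglongrightarrow> integral\<^sup>L lborel (\<lambda>y::real. 0::real)"
  proof (rule integral_dominated_convergence[where w = "\<lambda>y. \<bar>indicator (einterval l u) y *\<^sub>R q y\<bar>"])
    show "integrable lborel (\<lambda>y. \<bar>indicator (einterval l u) y *\<^sub>R q y\<bar>)"
      using int unfolding set_integrable_def by (rule integrable_abs)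
    have lX: "l \<le> ereal (X i)" for i
      using x X(2)[of i] unfolding einterval_iff by (meson less_imp_le less_trans)
    show "(\<lambda>y. indicator (einterval (X i) u) y *\<^sub>R q y) \<in> borel_measurable lborel" for i
      using set_integrable_einterval_subset[OF int lX[of i] order_refl]
      unfolding set_integrable_def by (rule borel_measurable_integrable)
    show "AE y in lborel. norm (indicator (einterval (X i) u) y *\<^sub>R q y) \<le> \<bar>indicator (einterval l u) y *\<^sub>R q y\<bar>" for i
      by (rule AE_I2) (use le_less_trans[OF lX[of i]] in \<open>auto simp: indicator_def einterval_iff\<close>)
    show "AE y in lborel. (\<lambda>i. indicator (einterval (X i) u) y *\<^sub>R q y) \<longlonglongrightarrow> 0"
    proof (rule AE_I2, rule tendsto_eventually)
      fix y
      show "\<forall>\<^sub>F i in sequentially. indicator (einterval (X i) u) y *\<^sub>R q y = 0"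
      proof (cases "ereal y < u")
        case True
        with X(4) have "\<forall>\<^sub>F i in sequentially. ereal y < ereal (X i)" by (rule order_tendstoD)
        then show ?thesis by eventually_elim (auto simp: indicator_def einterval_iff)
      qed (auto simp: indicator_def einterval_iff)
    qed
  qed simp
  then have "(\<lambda>i. \<bar>LBINT y=ereal (X i)..u. q y\<bar>) \<longlonglongrightarrow> 0"
    using X(3) by (auto simp: interval_lebesgue_integral_le_eq less_imp_le set_lebesgue_integral_def
        intro: tendsto_rabs_zero)
  then have "\<forall>\<^sub>F i in sequentially. \<bar>LBINT y=ereal (X i)..u. q y\<bar> < e"
    using \<open>0 < e\<close> by (rule order_tendstoD)
  then obtain i where "\<bar>LBINT y=ereal (X i)..u. q y\<bar> < e"
    by (auto simp: eventually_sequentially)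
  then show thesis
    using X(2,3)[of i] by (intro that[of "X i"]) auto
qed

lemma interval_integral_lower_vanishes:
  fixes q :: "real \<Rightarrow> real"
  assumes int: "set_integrable lborel (einterval l u) q" and x: "x \<in> einterval l u" and "0 < e"
  obtains b where "b \<le> x" "l < ereal b" "\<bar>LBINT y=l..ereal b. q y\<bar> < e"
proof -
  have "l < u" using x by (auto simp: einterval_iff intro: less_trans)
  then have "set_integrable lborel (einterval (-u) (-l)) (\<lambda>x. q (- x))"
    using int interval_integrable_mirror[of "-u" "-l" q]
    by (simp add: interval_lebesgue_integrable_def ereal_minus_le_minus less_imp_le)
  moreover have "- x \<in> einterval (-u) (-l)"
    using x by (auto simp: einterval_iff ereal_uminus_less_reorder ereal_less_uminus_reorder simp flip: uminus_ereal.simps)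
  ultimately obtain b where b: "- x \<le> b" "ereal b < - l" "\<bar>LBINT y=ereal b..-l. q (-y)\<bar> < e"
    using \<open>0 < e\<close> by (rule interval_integral_upper_vanishes) (rule that)
  show thesis
  proof (rule that[of "- b"])
    show "l < ereal (- b)"
      using b(2) by (metis ereal_less_uminus_reorder uminus_ereal.simps(1))
    show "\<bar>LBINT y=l..ereal (- b). q y\<bar> < e"
      using b(3) by (subst interval_integral_reflect) simp
  qed (use b in auto)
qed

lemma interval_integral_abs_le:
  fixes q p :: "real \<Rightarrow> real"
  assumes "a \<le> b" "set_integrable lborel (einterval a b) q" "set_integrable lborel (einterval a b) p"
    and "\<And>y. y \<in> einterval a b \<Longrightarrow> \<bar>q y\<bar> \<le> p y"
  shows "\<bar>LBINT y=a..b. q y\<bar> \<le> (LBINT y=a..b. p y)"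
proof -
  have "q y \<le> p y" "- q y \<le> p y" if "y \<in> einterval a b" for y
    using assms(4)[OF that] by auto
  then have "(LBINT y:einterval a b. q y) \<le> (LBINT y:einterval a b. p y)"
    "(LBINT y:einterval a b. (- 1) * q y) \<le> (LBINT y:einterval a b. p y)"
    using assms(2,3) by (intro set_integral_mono set_integrable_mult_right; simp)+
  then show ?thesis
    using assms(1,2) by (simp add: interval_lebesgue_integral_le_eq set_integral_uminus abs_le_iff)
qed

section \<open>The Stein equation of a centred density\<close>

text \<open>
  The formula for \<open>g\<close> is that of the Stein kernel of a centred law with density \<open>\<rho>\<close>.
\<close>
locale stein_density =
  fixes l u :: ereal and \<rho> g :: "real \<Rightarrow> real"
  assumes endpoints: "l < 0" "0 < u"
    and cont: "continuous_on (einterval l u) \<rho>"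
    and nonneg: "\<And>x. 0 \<le> \<rho> x"
    and integrable: "set_integrable lborel (einterval l u) \<rho>"
    and moment_integrable: "set_integrable lborel (einterval l u) (\<lambda>y. y * \<rho> y)"
    and mass: "(LBINT y=l..u. \<rho> y) = 1"
    and centred: "(LBINT y=l..u. y * \<rho> y) = 0"
    and g_kernel: "\<And>x. x \<in> einterval l u \<Longrightarrow> g x = 1 / \<rho> x * (LBINT y=ereal x..u. y * \<rho> y)"
    and g_pos: "\<And>x. x \<in> einterval l u \<Longrightarrow> 0 < g x"
begin

abbreviation "S \<equiv> einterval l u"

text \<open>
  \<open>V\<close> is the distribution function of the law and \<open>T\<close> its tail.  The function \<open>\<phi>\<close> equals \<open>g * \<rho>\<close> on \<open>(l, u)\<close>;
  it is differentiable there, with derivative \<open>- x * \<rho> x\<close>, although its factors need not be.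
\<close>
definition "V x = (LBINT y=l..ereal x. \<rho> y)"
definition "T x = (LBINT y=ereal x..u. \<rho> y)"
definition "\<phi> x = (LBINT y=ereal x..u. y * \<rho> y)"

lemma S_le: "x \<in> S \<Longrightarrow> l \<le> ereal x" "x \<in> S \<Longrightarrow> ereal x \<le> u"
  by (auto simp: einterval_iff)

lemma \<rho>_pos: "x \<in> S \<Longrightarrow> 0 < \<rho> x"
  using g_kernel[of x] g_pos[of x] nonneg[of x] by (cases "\<rho> x = 0") auto

lemma \<phi>_eq: "x \<in> S \<Longrightarrow> \<phi> x = g x * \<rho> x"
  using g_kernel[of x] \<rho>_pos[of x] by (simp add: \<phi>_def)

lemma \<phi>_pos: "x \<in> S \<Longrightarrow> 0 < \<phi> x"
  using \<phi>_eq g_pos \<rho>_pos by simp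

lemma moment_cont: "continuous_on S (\<lambda>y. y * \<rho> y)"
  by (intro continuous_intros cont)

lemma \<phi>_lower: "x \<in> S \<Longrightarrow> (LBINT y=l..ereal x. y * \<rho> y) = - \<phi> x"
  using interval_integral_split[OF moment_integrable, of l x u] centred S_le[of x]
  by (simp add: \<phi>_def)

lemma V_plus_T: "x \<in> S \<Longrightarrow> V x + T x = 1"
  using interval_integral_split[OF integrable, of l x u] mass S_le[of x]
  by (simp add: V_def T_def)

lemma V_nonneg: "x \<in> S \<Longrightarrow> 0 \<le> V x"
  using S_le[of x] nonneg unfolding V_def
  by (simp add: interval_lebesgue_integral_le_eq set_lebesgue_integral_def)

lemma T_nonneg: "x \<in> S \<Longrightarrow> 0 \<le> T x"
  using S_le[of x] nonneg unfolding T_def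
  by (simp add: interval_lebesgue_integral_le_eq set_lebesgue_integral_def)

lemma V_deriv: "x \<in> S \<Longrightarrow> (V has_real_derivative \<rho> x) (at x)"
  unfolding V_def by (rule interval_integral_lower_has_derivative[OF integrable cont])

lemma T_deriv: "x \<in> S \<Longrightarrow> (T has_real_derivative - \<rho> x) (at x)"
  unfolding T_def by (rule interval_integral_upper_has_derivative[OF integrable cont])

lemma \<phi>_deriv: "x \<in> S \<Longrightarrow> (\<phi> has_real_derivative - (x * \<rho> x)) (at x)"
  unfolding \<phi>_def by (rule interval_integral_upper_has_derivative[OF moment_integrable moment_cont])

lemma affine_integrable:
  assumes "l \<le> a" "b \<le> u"
  shows "set_integrable lborel (einterval a b) (\<lambda>y. (c + d * y) * \<rho> y)"
proof -
  have "set_integrable lborel (einterval a b) (\<lambda>y. c * \<rho> y + d * (y * \<rho> y))"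
    using set_integrable_einterval_subset[OF integrable assms]
      set_integrable_einterval_subset[OF moment_integrable assms]
    by (intro set_integral_add set_integrable_mult_right) auto
  then show ?thesis by (simp add: algebra_simps)
qed

lemma affine_integral:
  assumes "l \<le> a" "a \<le> b" "b \<le> u"
  shows "(LBINT y=a..b. (c + d * y) * \<rho> y) = c * (LBINT y=a..b. \<rho> y) + d * (LBINT y=a..b. y * \<rho> y)"
proof -
  have "(LBINT y=a..b. (c + d * y) * \<rho> y) = (LBINT y=a..b. c * \<rho> y + d * (y * \<rho> y))"
    by (simp add: algebra_simps)
  also have "\<dots> = (LBINT y=a..b. c * \<rho> y) + (LBINT y=a..b. d * (y * \<rho> y))"
    using set_integrable_einterval_subset[OF integrable assms(1,3)]
      set_integrable_einterval_subset[OF moment_integrable assms(1,3)] assms(2)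
    by (intro interval_lebesgue_integral_add) (auto simp: interval_lebesgue_integrable_def)
  finally show ?thesis by simp
qed

text \<open>
  This integral bounds the contribution of \<open>(x, u)\<close> to the Stein equation for a Lipschitz right-hand
  side.  By Fubini it is also the integral of \<open>T\<close> over \<open>(x, u)\<close>.
\<close>
lemma upper_deficit:
  assumes "x \<in> S"
  shows "(LBINT y=ereal x..u. (y - x) * \<rho> y) = \<phi> x - x * T x" "0 \<le> \<phi> x - x * T x"
proof -
  show eq: "(LBINT y=ereal x..u. (y - x) * \<rho> y) = \<phi> x - x * T x"
    using affine_integral[of x u "- x" 1] S_le[OF assms] by (simp add: \<phi>_def T_def)
  have "0 \<le> (LBINT y=ereal x..u. (y - x) * \<rho> y)"
    using S_le[OF assms] nonneg
    by (auto simp: interval_lebesgue_integral_le_eq set_lebesgue_integral_def einterval_iff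
        intro!: integral_nonneg split: split_indicator)
  then show "0 \<le> \<phi> x - x * T x" by (simp add: eq)
qed

lemma lower_deficit:
  assumes "x \<in> S"
  shows "(LBINT y=l..ereal x. (x - y) * \<rho> y) = \<phi> x + x * V x" "0 \<le> \<phi> x + x * V x"
proof -
  show eq: "(LBINT y=l..ereal x. (x - y) * \<rho> y) = \<phi> x + x * V x"
    using affine_integral[of l x x "- 1"] S_le[OF assms] \<phi>_lower[OF assms] by (simp add: V_def)
  have "0 \<le> (LBINT y=l..ereal x. (x - y) * \<rho> y)"
    using S_le[OF assms] nonneg
    by (auto simp: interval_lebesgue_integral_le_eq set_lebesgue_integral_def einterval_iff
        intro!: integral_nonneg split: split_indicator)
  then show "0 \<le> \<phi> x + x * V x" by (simp add: eq)
qed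

lemma lipschitz_integrable:
  assumes "K-lipschitz_on UNIV h" "l \<le> a" "b \<le> u"
  shows "set_integrable lborel (einterval a b) (\<lambda>y. h y * \<rho> y)"
proof (rule set_integrable_bound)
  have K: "0 \<le> K" "\<bar>h y - h 0\<bar> \<le> K * \<bar>y\<bar>" for y
    using assms(1) lipschitz_onD[OF assms(1), of y 0] by (auto simp: lipschitz_on_def dist_real_def)
  show "set_integrable lborel (einterval a b) (\<lambda>y. \<bar>h 0\<bar> * \<rho> y + K * \<bar>y * \<rho> y\<bar>)"
    using set_integrable_einterval_subset[OF integrable assms(2,3)]
      set_integrable_einterval_subset[OF moment_integrable assms(2,3)]
    by (intro set_integral_add set_integrable_mult_right set_integrable_abs) auto
  have "h \<in> borel_measurable borel"
    by (rule borel_measurable_continuous_onI[OF lipschitz_on_continuous_on[OF assms(1)]])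
  moreover have "(\<lambda>y. indicator (einterval a b) y *\<^sub>R \<rho> y) \<in> borel_measurable lborel"
    using set_integrable_einterval_subset[OF integrable assms(2,3)]
    unfolding set_integrable_def by (rule borel_measurable_integrable)
  ultimately have "(\<lambda>y. h y * (indicator (einterval a b) y *\<^sub>R \<rho> y)) \<in> borel_measurable lborel"
    by (intro borel_measurable_times) auto
  then show "set_borel_measurable lborel (einterval a b) (\<lambda>y. h y * \<rho> y)"
    unfolding set_borel_measurable_def by (simp add: mult_ac)
  have "\<bar>h y * \<rho> y\<bar> \<le> \<bar>h 0\<bar> * \<rho> y + K * \<bar>y * \<rho> y\<bar>" for y
  proof -
    have "\<bar>h y\<bar> * \<rho> y \<le> (\<bar>h 0\<bar> + K * \<bar>y\<bar>) * \<rho> y"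
      using K(2)[of y] nonneg[of y] by (intro mult_right_mono) auto
    then show ?thesis using nonneg[of y] by (simp add: abs_mult algebra_simps)
  qed
  moreover have "0 \<le> \<bar>h 0\<bar> * \<rho> y + K * \<bar>y * \<rho> y\<bar>" for y
    using K nonneg[of y] by simp
  ultimately show "AE y in lborel. y \<in> einterval a b \<longrightarrow>
      norm (h y * \<rho> y) \<le> norm (\<bar>h 0\<bar> * \<rho> y + K * \<bar>y * \<rho> y\<bar>)"
    by auto
qed

text \<open>
  The solution is \<open>H / \<phi>\<close> with \<open>H' = (h - m) * \<rho>\<close>, and the Stein equation is the quotient rule.  For the
  estimate let \<open>a\<close> and \<open>b\<close> be the integrals of \<open>(h - h x) * \<rho>\<close> over \<open>(l, x)\<close> and \<open>(x, u)\<close>.  Then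
  \<open>m = a + b + h x\<close> and \<open>H x = a * T x - b * V x\<close>, so that
  \<open>\<phi> * g * f' = - a * (\<phi> - x * T) - b * (\<phi> + x * V)\<close>.  The Lipschitz condition bounds \<open>\<bar>a\<bar>\<close> and \<open>\<bar>b\<bar>\<close> by
  \<open>K\<close> times the two deficits, which makes both terms multiples of the same product.
\<close>
lemma stein_solution_derivative:
  assumes lip: "K-lipschitz_on UNIV h" and m: "m = (LBINT y=l..u. h y * \<rho> y)" and x: "x \<in> S"
  obtains f' where "(stein_solution g \<rho> l h m has_real_derivative f') (at x)"
    "g x * f' - x * stein_solution g \<rho> l h m x = h x - m"
    "\<bar>f'\<bar> * (\<phi> x * g x) \<le> 2 * K * ((\<phi> x - x * T x) * (\<phi> x + x * V x))"
proof -
  have K: "0 \<le> K" "\<bar>h y - h z\<bar> \<le> K * \<bar>y - z\<bar>" for y z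
    using lip by (auto simp: lipschitz_on_def dist_real_def)
  have h_cont: "continuous_on S h"
    using lipschitz_on_continuous_on[OF lip] by (rule continuous_on_subset) auto
  have \<rho>_int: "set_integrable lborel (einterval a b) \<rho>" if "l \<le> a" "b \<le> u" for a b
    using set_integrable_einterval_subset[OF integrable that] .
  note h_int = lipschitz_integrable[OF lip]
  note le = S_le[OF x]
  have ii: "interval_lebesgue_integrable lborel a b q" if "a \<le> b" "set_integrable lborel (einterval a b) q" for a b and q :: "real \<Rightarrow> real"
    using that by (simp add: interval_lebesgue_integrable_def)
  define H where "H z = (LBINT y=l..ereal z. (h y - m) * \<rho> y)" for z
  have hm_int: "set_integrable lborel (einterval a b) (\<lambda>y. (h y - c) * \<rho> y)" if "l \<le> a" "b \<le> u" for a b c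
    using set_integral_diff(1)[OF h_int[OF that] set_integrable_mult_right[of c, OF \<rho>_int[OF that]]]
    by (simp add: left_diff_distrib)
  have hm_integral: "(LBINT y=a..b. (h y - c) * \<rho> y) = (LBINT y=a..b. h y * \<rho> y) - c * (LBINT y=a..b. \<rho> y)"
    if "l \<le> a" "a \<le> b" "b \<le> u" for a b c
    using interval_lebesgue_integral_diff(2)[OF ii[OF that(2) h_int[OF that(1,3)]]
        interval_lebesgue_integrable_mult_right[of c, OF ii[OF that(2) \<rho>_int[OF that(1,3)]]]]
    by (simp add: left_diff_distrib)
  have H_deriv: "(H has_real_derivative (h x - m) * \<rho> x) (at x)"
    unfolding H_def
    by (rule interval_integral_lower_has_derivative[OF hm_int[OF order_refl order_refl] _ x])
      (intro continuous_intros h_cont cont)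
  define f' where "f' = (((h x - m) * \<rho> x) * \<phi> x + H x * (x * \<rho> x)) / (\<phi> x * \<phi> x)"
  have f_eq: "stein_solution g \<rho> l h m z = H z / \<phi> z" if "z \<in> S" for z
    using \<phi>_eq[OF that] by (simp add: stein_solution_def H_def)
  have "((\<lambda>z. H z / \<phi> z) has_real_derivative f') (at x)"
    unfolding f'_def using \<phi>_pos[OF x]
    by (auto intro!: derivative_eq_intros H_deriv \<phi>_deriv[OF x])
  then have 1: "(stein_solution g \<rho> l h m has_real_derivative f') (at x)"
    by (rule has_field_derivative_transform_within_open[of _ _ _ S]) (auto simp: x f_eq)
  have gx: "g x = \<phi> x / \<rho> x" using \<phi>_eq[OF x] \<rho>_pos[OF x] by simp
  have gf': "g x * f' = (h x - m) + x * H x / \<phi> x"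
    unfolding gx f'_def using \<phi>_pos[OF x] \<rho>_pos[OF x] by (simp add: field_simps)
  define a where "a = (LBINT y=l..ereal x. (h y - h x) * \<rho> y)"
  define b where "b = (LBINT y=ereal x..u. (h y - h x) * \<rho> y)"
  have a_eq: "(LBINT y=l..ereal x. h y * \<rho> y) = a + h x * V x"
    using hm_integral[of l x "h x"] le by (simp add: a_def V_def)
  have b_eq: "(LBINT y=ereal x..u. h y * \<rho> y) = b + h x * T x"
    using hm_integral[of x u "h x"] le by (simp add: b_def T_def)
  have T: "T x = 1 - V x" using V_plus_T[OF x] by simp
  have m_eq: "m = a + b + h x"
    using interval_integral_split[OF h_int[OF order_refl order_refl], of l x u] le
    unfolding m a_eq b_eq T by (simp add: algebra_simps)
  have H_eq: "H x = a * T x - b * V x"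
    unfolding H_def using hm_integral[of l x m] le a_eq
    by (simp add: V_def[symmetric] T m_eq algebra_simps)
  have "g x * f' = - (a + b) + x * (a * T x - b * V x) / \<phi> x"
    unfolding gf' H_eq by (simp add: m_eq)
  then have key: "\<phi> x * (g x * f') = - a * (\<phi> x - x * T x) - b * (\<phi> x + x * V x)"
    using \<phi>_pos[OF x] by (simp add: field_simps)
  have "\<bar>a\<bar> \<le> (LBINT y=l..ereal x. K * ((x - y) * \<rho> y))"
    unfolding a_def
  proof (rule interval_integral_abs_le[OF le(1) hm_int[OF order_refl le(2)]])
    show "set_integrable lborel (einterval l x) (\<lambda>y. K * ((x - y) * \<rho> y))"
      using affine_integrable[OF order_refl le(2), of x "-1"] by simp
    fix y assume "y \<in> einterval l x"
    then have "\<bar>h y - h x\<bar> \<le> K * (x - y)" using K(2)[of y x] by (simp add: einterval_iff)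
    then have "\<bar>h y - h x\<bar> * \<rho> y \<le> K * (x - y) * \<rho> y"
      by (rule mult_right_mono) (rule nonneg)
    then show "\<bar>(h y - h x) * \<rho> y\<bar> \<le> K * ((x - y) * \<rho> y)"
      using nonneg[of y] by (simp add: abs_mult)
  qed
  then have a_le: "\<bar>a\<bar> \<le> K * (\<phi> x + x * V x)"
    using lower_deficit(1)[OF x] by simp
  have "\<bar>b\<bar> \<le> (LBINT y=ereal x..u. K * ((y - x) * \<rho> y))"
    unfolding b_def
  proof (rule interval_integral_abs_le[OF le(2) hm_int[OF le(1) order_refl]])
    show "set_integrable lborel (einterval x u) (\<lambda>y. K * ((y - x) * \<rho> y))"
      using affine_integrable[OF le(1) order_refl, of "-x" "1"] by simp
    fix y assume "y \<in> einterval x u"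
    then have "\<bar>h y - h x\<bar> \<le> K * (y - x)" using K(2)[of y x] by (simp add: einterval_iff)
    then have "\<bar>h y - h x\<bar> * \<rho> y \<le> K * (y - x) * \<rho> y"
      by (rule mult_right_mono) (rule nonneg)
    then show "\<bar>(h y - h x) * \<rho> y\<bar> \<le> K * ((y - x) * \<rho> y)"
      using nonneg[of y] by (simp add: abs_mult)
  qed
  then have b_le: "\<bar>b\<bar> \<le> K * (\<phi> x - x * T x)"
    using upper_deficit(1)[OF x] by simp
  have "\<bar>f'\<bar> * (\<phi> x * g x) = \<bar>\<phi> x * (g x * f')\<bar>"
    using \<phi>_pos[OF x] g_pos[OF x] by (simp add: abs_mult)
  also have "\<dots> \<le> \<bar>a\<bar> * (\<phi> x - x * T x) + \<bar>b\<bar> * (\<phi> x + x * V x)"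
    unfolding key using upper_deficit(2)[OF x] lower_deficit(2)[OF x]
    by (intro order_trans[OF abs_triangle_ineq4]) (simp add: abs_mult)
  also have "\<dots> \<le> K * (\<phi> x + x * V x) * (\<phi> x - x * T x) + K * (\<phi> x - x * T x) * (\<phi> x + x * V x)"
    using upper_deficit(2)[OF x] lower_deficit(2)[OF x] a_le b_le
    by (intro add_mono mult_right_mono) auto
  finally have 3: "\<bar>f'\<bar> * (\<phi> x * g x) \<le> 2 * K * ((\<phi> x - x * T x) * (\<phi> x + x * V x))"
    by (simp add: mult_ac)
  show thesis
    by (rule that[OF 1 _ 3]) (simp add: gf' f_eq[OF x])
qed

text \<open>
  Near \<open>u\<close> this is \<open>product_estimate_at_upper_end\<close>, near \<open>l\<close> it is the same lemma after the
  reflection \<open>x \<mapsto> - x\<close>, and on the compact interval in between the quotient of the two sides is continuous.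
\<close>
lemma product_estimate:
  fixes G G' :: "real \<Rightarrow> real"
  assumes G': "\<And>x. x \<in> S \<Longrightarrow> (G has_real_derivative G' x) (at x)"
    and G: "\<And>x. x \<in> S \<Longrightarrow> 0 < G x"
    and upper: "\<forall>\<^sub>F x in to_upper u. \<alpha> \<le> g x / G x" "0 < \<alpha>" "\<forall>\<^sub>F x in to_upper u. g x / G x \<le> \<beta>"
      "((\<lambda>x. ereal (G' x)) \<longlongrightarrow> d) (to_upper u)"
    and lower: "\<forall>\<^sub>F x in to_lower l. \<alpha>' \<le> g x / G x" "0 < \<alpha>'" "\<forall>\<^sub>F x in to_lower l. g x / G x \<le> \<beta>'"
      "((\<lambda>x. ereal (G' x)) \<longlongrightarrow> d') (to_lower l)"
  obtains k where "\<And>x. x \<in> S \<Longrightarrow> (\<phi> x - x * T x) * (\<phi> x + x * V x) \<le> k * (\<phi> x * g x)"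
proof -
  have SU: "x \<in> S" if "0 < x" "ereal x < u" for x
    using that endpoints by (auto simp: einterval_iff intro: less_trans)
  have SL: "- x \<in> S" if "0 < x" "ereal x < - l" for x
  proof -
    have "l < ereal (- x)"
      using that(2) by (metis ereal_less_uminus_reorder uminus_ereal.simps(1))
    moreover have "ereal (- x) < 0" using that(1) by simp
    ultimately show ?thesis
      using endpoints by (auto simp: einterval_iff simp del: ereal_less intro: less_trans)
  qed
  have "l \<noteq> \<infinity>" "0 < - l" using endpoints by (auto simp: ereal_less_uminus_reorder)
  have V1: "V x \<le> 1" and T1: "T x \<le> 1" if "x \<in> S" for x
    using V_plus_T[OF that] V_nonneg[OF that] T_nonneg[OF that] by auto
  have vanU: "\<exists>b. x \<le> b \<and> ereal b < u \<and> \<phi> b < e" if "0 < x" "ereal x < u" "0 < e" for x e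
    by (rule interval_integral_upper_vanishes[OF moment_integrable SU[OF that(1,2)] that(3)])
      (auto simp: \<phi>_def abs_less_iff)
  have vanL: "\<exists>b. x \<le> b \<and> ereal b < - l \<and> \<phi> (- b) < e" if x: "0 < x" "ereal x < - l" "0 < e" for x e
  proof (rule interval_integral_lower_vanishes[OF moment_integrable SL[OF x(1,2)] x(3)])
    fix b assume b: "b \<le> - x" "l < ereal b" "\<bar>LBINT y=l..ereal b. y * \<rho> y\<bar> < e"
    have "ereal b < 0" using b(1) x(1) by simp
    then have "ereal b < u" using endpoints by (meson less_trans)
    then have "\<phi> b < e" using \<phi>_lower[of b] b by (auto simp: einterval_iff)
    moreover have "ereal (- b) < - l"
      using b(2) by (simp flip: uminus_ereal.simps)
    ultimately show ?thesis using b(1) by (intro exI[of _ "- b"]) auto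
  qed
  note lower' = lower[unfolded to_lower_eq_filtermap_to_upper[OF \<open>l \<noteq> \<infinity>\<close>] eventually_filtermap filterlim_filtermap]
  obtain b1 k1 where 1: "0 < b1" "ereal b1 < u"
    and up: "\<And>x. b1 \<le> x \<Longrightarrow> ereal x < u \<Longrightarrow> (\<phi> x - x * T x) * (\<phi> x + x * V x) \<le> k1 * (\<phi> x * g x)"
    by (rule product_estimate_at_upper_end[where u = u and \<phi> = \<phi> and T = T and V = V and \<rho> = \<rho> and g = g
          and G = G and G' = G' and d = d and \<alpha> = \<alpha> and \<gamma> = \<beta>])
      (assumption | rule that endpoints(2) upper vanU \<phi>_deriv[OF SU] T_deriv[OF SU] G'[OF SU] G[OF SU]
        \<rho>_pos[OF SU] T_nonneg[OF SU] V1[OF SU] upper_deficit(2)[OF SU] g_pos[OF SU] \<phi>_eq[OF SU])+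
  have lim: "((\<lambda>x. ereal (- G' (- x))) \<longlongrightarrow> - d') (to_upper (- l))"
    using tendsto_uminus_ereal[OF lower'(4)] by simp
  have low_deficit: "0 \<le> \<phi> (- x) - x * V (- x)" if "0 < x" "ereal x < - l" for x
    using lower_deficit(2)[OF SL[OF that]] by simp
  obtain b2 k2 where 2: "0 < b2" "ereal b2 < - l"
    and low: "\<And>x. b2 \<le> x \<Longrightarrow> ereal x < - l \<Longrightarrow>
      (\<phi> (- x) - x * V (- x)) * (\<phi> (- x) + x * T (- x)) \<le> k2 * (\<phi> (- x) * g (- x))"
  proof (rule product_estimate_at_upper_end[where u = "- l" and \<phi> = "\<lambda>x. \<phi> (- x)" and T = "\<lambda>x. V (- x)"
        and V = "\<lambda>x. T (- x)" and \<rho> = "\<lambda>x. \<rho> (- x)" and g = "\<lambda>x. g (- x)"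
        and G = "\<lambda>x. G (- x)" and G' = "\<lambda>x. - G' (- x)" and d = "- d'" and \<alpha> = \<alpha>' and \<gamma> = \<beta>'])
    show "((\<lambda>x. \<phi> (- x)) has_real_derivative - (x * \<rho> (- x))) (at x)" if "0 < x" "ereal x < - l" for x
      using \<phi>_deriv[OF SL[OF that], THEN DERIV_mirror[THEN iffD1]] by simp
    show "((\<lambda>x. V (- x)) has_real_derivative - \<rho> (- x)) (at x)" if "0 < x" "ereal x < - l" for x
      using V_deriv[OF SL[OF that], THEN DERIV_mirror[THEN iffD1]] by simp
    show "((\<lambda>x. G (- x)) has_real_derivative - G' (- x)) (at x)" if "0 < x" "ereal x < - l" for x
      using G'[OF SL[OF that], THEN DERIV_mirror[THEN iffD1]] by simp
  qed (assumption | rule that \<open>0 < - l\<close> lower'(1-3) vanL lim low_deficit G[OF SL]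
      \<rho>_pos[OF SL] V_nonneg[OF SL] T1[OF SL] g_pos[OF SL] \<phi>_eq[OF SL])+
  define Q where "Q x = (\<phi> x - x * T x) * (\<phi> x + x * V x) / (\<phi> x * g x)" for x
  have sub: "{- b2..b1} \<subseteq> S"
  proof
    fix x assume "x \<in> {- b2..b1}"
    then show "x \<in> S"
      using SU[OF 1(1,2)] SL[OF 2(1,2)] by (auto simp: einterval_iff intro: less_le_trans[of l] le_less_trans[of _ "ereal b1"])
  qed
  have cont_of: "continuous_on S F" if "\<And>x. x \<in> S \<Longrightarrow> (F has_real_derivative F' x) (at x)" for F F'
    using that by (meson DERIV_isCont continuous_at_imp_continuous_on)
  have "continuous_on S (\<lambda>x. \<phi> x / \<rho> x)"
    by (intro continuous_intros cont cont_of[OF \<phi>_deriv]) (use \<rho>_pos in force)+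
  then have g_cont: "continuous_on S g"
    by (rule continuous_on_eq) (use \<phi>_eq \<rho>_pos in force)
  have "continuous_on S Q"
    unfolding Q_def
    by (intro continuous_intros g_cont cont_of[OF \<phi>_deriv] cont_of[OF T_deriv] cont_of[OF V_deriv])
      (use \<phi>_pos g_pos in force)+
  then have "bounded (Q ` {- b2..b1})"
    by (intro compact_imp_bounded compact_continuous_image) (auto intro: continuous_on_subset[OF _ sub])
  then obtain k3 where k3: "\<forall>x\<in>{- b2..b1}. \<bar>Q x\<bar> \<le> k3"
    unfolding bounded_iff by auto
  show thesis
  proof (rule that[of "max k1 (max k2 k3)"])
    fix x assume x: "x \<in> S"
    have pos: "0 < \<phi> x * g x" using \<phi>_pos[OF x] g_pos[OF x] by simp
    have "\<exists>k\<in>{k1, k2, k3}. (\<phi> x - x * T x) * (\<phi> x + x * V x) \<le> k * (\<phi> x * g x)"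
    proof -
      consider "b1 \<le> x" | "b2 \<le> - x" | "x \<in> {- b2..b1}" by fastforce
      then show ?thesis
      proof cases
        case 1
        then show ?thesis using up x by (auto simp: einterval_iff)
      next
        case 2
        have "ereal (- x) < - l" using x by (simp add: einterval_iff flip: uminus_ereal.simps)
        with 2 show ?thesis using low[of "- x"] by (simp add: mult.commute)
      next
        case 3
        then have "Q x \<le> k3" using k3 by force
        then show ?thesis using pos by (simp add: Q_def field_simps)
      qed
    qed
    then show "(\<phi> x - x * T x) * (\<phi> x + x * V x) \<le> max k1 (max k2 k3) * (\<phi> x * g x)"
      using pos by (auto elim!: order_trans intro!: mult_right_mono)
  qed
qed

end

section \<open>The law of a random variable supported on an interval\<close>

text \<open>
  The complement of the support is a union of open null sets, hence null by the Lindelof property; the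
  closure of an interval exceeds the interval by its frontier, which is null as well.
\<close>
lemma AE_zero_outside_support:
  fixes \<rho> :: "real \<Rightarrow> real"
  assumes "distributed M lborel Z (\<lambda>x. ennreal (\<rho> x))" "\<And>x. 0 \<le> \<rho> x"
    and supp: "measure_support (distr M borel Z) = closure (einterval l u)"
  shows "AE x in lborel. x \<notin> einterval l u \<longrightarrow> \<rho> x = 0"
proof -
  let ?C = "closure (einterval l u)"
  have distr: "distr M lborel Z = density lborel (\<lambda>x. ennreal (\<rho> x))"
    and [measurable]: "(\<lambda>x. ennreal (\<rho> x)) \<in> borel_measurable lborel"
    using assms(1) by (auto simp: distributed_def)
  have dd: "distr M borel Z = distr M lborel Z"
    by (rule distr_cong) auto
  have "\<exists>U. open U \<and> x \<in> U \<and> emeasure (distr M lborel Z) U = 0" if "x \<notin> ?C" for x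
    using that unfolding supp[symmetric] measure_support_def dd by (auto simp: zero_less_iff_neq_zero)
  then obtain U where U: "\<And>x. x \<notin> ?C \<Longrightarrow> open (U x) \<and> x \<in> U x \<and> emeasure (distr M lborel Z) (U x) = 0"
    by metis
  obtain \<U> where \<U>: "\<U> \<subseteq> U ` (- ?C)" "countable \<U>" "\<Union>\<U> = \<Union>(U ` (- ?C))"
    using Lindelof[of "U ` (- ?C)"] U by auto
  have "\<Union>\<U> \<in> null_sets (distr M lborel Z)"
  proof (rule null_sets_UN'[OF \<U>(2), of "\<lambda>x. x", simplified])
    fix X assume "X \<in> \<U>"
    then show "X \<in> null_sets (distr M lborel Z)"
      using \<U>(1) U by fastforce
  qed
  then have "AE x in density lborel (\<lambda>x. ennreal (\<rho> x)). x \<notin> \<Union>\<U>"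
    unfolding distr by (rule AE_not_in)
  then have "AE x in lborel. 0 < ennreal (\<rho> x) \<longrightarrow> x \<notin> \<Union>\<U>"
    by (subst (asm) AE_density) auto
  moreover have "AE x in lborel. x \<notin> frontier (einterval l u)"
  proof -
    have "convex (einterval l u)"
      unfolding is_interval_convex_1[symmetric] is_interval_1
    proof (intro ballI allI impI)
      fix a b x assume "a \<in> einterval l u" "b \<in> einterval l u" "a \<le> x \<and> x \<le> b"
      then have "l < ereal a" "ereal a \<le> ereal x" "ereal x \<le> ereal b" "ereal b < u"
        by (auto simp: einterval_iff)
      then show "x \<in> einterval l u"
        unfolding einterval_iff by (meson less_le_trans le_less_trans)
    qed
    then have "frontier (einterval l u) \<in> null_sets lborel"
      using negligible_convex_frontier[of "einterval l u"]
      by (auto simp: negligible_iff_null_sets null_sets_def)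
    then show ?thesis by (rule AE_not_in)
  qed
  ultimately show ?thesis
  proof (eventually_elim, intro impI)
    fix x assume *: "0 < ennreal (\<rho> x) \<longrightarrow> x \<notin> \<Union>\<U>" "x \<notin> frontier (einterval l u)" "x \<notin> einterval l u"
    then have "x \<notin> ?C" by (auto simp: frontier_def interior_open)
    then have "x \<in> \<Union>\<U>"
      unfolding \<U>(3) using U by auto
    then have "\<not> 0 < \<rho> x" using * by auto
    then show "\<rho> x = 0" using assms(2)[of x] by auto
  qed
qed

lemma interval_integral_density:
  fixes \<rho> h :: "real \<Rightarrow> real"
  assumes d: "distributed M lborel Z (\<lambda>x. ennreal (\<rho> x))" "\<And>x. 0 \<le> \<rho> x"
    and supp: "measure_support (distr M borel Z) = closure (einterval l u)"
    and "l \<le> u" and h: "h \<in> borel_measurable borel"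
  shows "(LBINT y=l..u. h y * \<rho> y) = integral\<^sup>L M (\<lambda>\<omega>. h (Z \<omega>))"
    and "integrable M (\<lambda>\<omega>. h (Z \<omega>)) \<Longrightarrow> set_integrable lborel (einterval l u) (\<lambda>y. h y * \<rho> y)"
proof -
  have "(\<lambda>x. enn2real (ennreal (\<rho> x))) \<in> borel_measurable lborel"
    using d(1) by (intro borel_measurable_enn2real) (auto simp: distributed_def)
  then have [measurable]: "\<rho> \<in> borel_measurable borel"
    using d(2) by simp
  note [measurable] = h
  have "AE y in lborel. indicator (einterval l u) y *\<^sub>R (h y * \<rho> y) = \<rho> y * h y"
    using AE_zero_outside_support[OF d supp] by eventually_elim (auto simp: indicator_def)
  then have "(LBINT y=l..u. h y * \<rho> y) = (\<integral>y. \<rho> y * h y \<partial>lborel)"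
    using \<open>l \<le> u\<close> unfolding interval_lebesgue_integral_le_eq[OF \<open>l \<le> u\<close>] set_lebesgue_integral_def
    by (intro integral_cong_AE) auto
  also have "\<dots> = integral\<^sup>L M (\<lambda>\<omega>. h (Z \<omega>))"
    using d h by (intro distributed_integral) auto
  finally show "(LBINT y=l..u. h y * \<rho> y) = integral\<^sup>L M (\<lambda>\<omega>. h (Z \<omega>))" .
  assume "integrable M (\<lambda>\<omega>. h (Z \<omega>))"
  then have "integrable lborel (\<lambda>y. \<rho> y * h y)"
    using distributed_integrable[OF d(1), of h] d h by auto
  then have "integrable lborel (\<lambda>y. indicator (einterval l u) y *\<^sub>R (\<rho> y * h y))"
    by (intro integrable_mult_indicator) auto
  then show "set_integrable lborel (einterval l u) (\<lambda>y. h y * \<rho> y)"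
    by (simp add: set_integrable_def mult.commute)
qed

section \<open>The bound on the derivative of the Stein solution\<close>

theorem theorem9:
  fixes M :: "'a measure"
    and W :: "'h::{real_inner, banach, second_countable_topology} \<Rightarrow> 'a \<Rightarrow> real"
    and Z :: "'a \<Rightarrow> real"
    and \<rho> g :: "real \<Rightarrow> real"
    and l u :: ereal
  assumes isonormal: "isonormal_gaussian M W"
    and Z_D12: "Z \<in> isonormal_gaussian.D12 M W"
    and mean_zero: "integral\<^sup>L M Z = 0"
    and endpoints: "l < 0" "0 < u"
    and support: "measure_support (distr M borel Z) = closure (einterval l u)"
    and density: "distributed M lborel Z (\<lambda>x. ennreal (\<rho> x))" "\<And>x. 0 \<le> \<rho> x"
    and density_cont: "continuous_on (einterval l u) \<rho>"
    and g_cond_exp: "AE \<omega> in M. g (Z \<omega>) = isonormal_gaussian.cond_stein_kernel M W Z \<omega>"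
    and g_version: "\<And>z. z \<in> einterval l u \<Longrightarrow>
          g z = 1 / \<rho> z * (LBINT y=ereal z..u. y * \<rho> y)"
    and g_pos: "\<And>z. z \<in> einterval l u \<Longrightarrow> 0 < g z"
    and g_upper: "u = \<infinity> \<Longrightarrow> 0 < Liminf (to_upper u) (\<lambda>x. ereal (g x))"
    and g_lower: "l = -\<infinity> \<Longrightarrow> 0 < Liminf (to_lower l) (\<lambda>x. ereal (g x))"
    and comparison: "\<exists>gt :: real \<Rightarrow> real.
          gt C1_differentiable_on (einterval l u) \<and> (\<forall>x\<in>einterval l u. 0 < gt x) \<and>
          0 < Liminf (to_upper u) (\<lambda>x. ereal (g x / gt x)) \<and>
          Limsup (to_upper u) (\<lambda>x. ereal (g x / gt x)) < \<infinity> \<and>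
          (\<exists>d::ereal. ((\<lambda>x. ereal (deriv gt x)) \<longlongrightarrow> d) (to_upper u)) \<and>
          0 < Liminf (to_lower l) (\<lambda>x. ereal (g x / gt x)) \<and>
          Limsup (to_lower l) (\<lambda>x. ereal (g x / gt x)) < \<infinity> \<and>
          (\<exists>d::ereal. ((\<lambda>x. ereal (deriv gt x)) \<longlongrightarrow> d) (to_lower l))"
  shows "\<exists>k::real. \<forall>h::real \<Rightarrow> real.
           (\<exists>C. C-lipschitz_on UNIV h) \<longrightarrow> deriv_esssup h < \<infinity> \<longrightarrow>
           (let m = integral\<^sup>L M (\<lambda>\<omega>. h (Z \<omega>)); f = stein_solution g \<rho> l h m in
              (\<forall>x\<in>einterval l u. f differentiable (at x) \<and> g x * deriv f x - x * f x = h x - m) \<and>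
              (SUP x\<in>einterval l u. ereal \<bar>deriv f x\<bar>) \<le> ereal k * deriv_esssup h)"
proof -
  interpret W: isonormal_gaussian M W by (rule isonormal)
  have "Z \<in> W.L2"
    using Z_D12 by (auto simp: W.D12_def W.has_malliavin_deriv_def)
  then have "Z \<in> borel_measurable M" and "integrable M (\<lambda>\<omega>. (Z \<omega>)\<^sup>2)"
    by (auto simp: W.L2_def)
  then have Z_int: "integrable M Z"
    by (rule W.square_integrable_imp_integrable)
  have "l \<le> u" using endpoints by auto
  note law = interval_integral_density[OF density support \<open>l \<le> u\<close>]
  have "set_integrable lborel (einterval l u) (\<lambda>y. 1 * \<rho> y)"
    by (rule law(2)) auto
  then have int: "set_integrable lborel (einterval l u) \<rho>"
    unfolding mult_1 .
  have moment_int: "set_integrable lborel (einterval l u) (\<lambda>y. y * \<rho> y)"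
    by (rule law(2)) (use Z_int in auto)
  have "(LBINT y=l..u. 1 * \<rho> y) = integral\<^sup>L M (\<lambda>\<omega>. 1)"
    by (rule law(1)) auto
  then have mass: "(LBINT y=l..u. \<rho> y) = 1"
    by (simp add: W.prob_space)
  have "(LBINT y=l..u. y * \<rho> y) = integral\<^sup>L M Z"
    by (rule law(1)) auto
  then have centred: "(LBINT y=l..u. y * \<rho> y) = 0"
    using mean_zero by (rule trans)
  interpret stein_density l u \<rho> g
    by unfold_locales (fact endpoints density_cont density(2) int moment_int mass centred g_version g_pos)+
  obtain G d d' where G: "G C1_differentiable_on S" "\<And>x. x \<in> S \<Longrightarrow> 0 < G x"
    and upper: "0 < Liminf (to_upper u) (\<lambda>x. ereal (g x / G x))"
      "Limsup (to_upper u) (\<lambda>x. ereal (g x / G x)) < \<infinity>"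
      "((\<lambda>x. ereal (deriv G x)) \<longlongrightarrow> d) (to_upper u)"
    and lower: "0 < Liminf (to_lower l) (\<lambda>x. ereal (g x / G x))"
      "Limsup (to_lower l) (\<lambda>x. ereal (g x / G x)) < \<infinity>"
      "((\<lambda>x. ereal (deriv G x)) \<longlongrightarrow> d') (to_lower l)"
    using comparison by blast
  have G': "(G has_real_derivative deriv G x) (at x)" if "x \<in> S" for x
    using G(1) that unfolding C1_differentiable_on_def
    by (metis DERIV_imp_deriv has_real_derivative_iff_has_vector_derivative)
  have low_bound: "\<exists>\<alpha>>0. \<forall>\<^sub>F x in F. \<alpha> \<le> g x / G x"
    if pos: "0 < Liminf F (\<lambda>x. ereal (g x / G x))" for F
  proof -
    obtain \<alpha> where "0 < ereal \<alpha>" "ereal \<alpha> < Liminf F (\<lambda>x. ereal (g x / G x))"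
      using ereal_dense2[OF pos] by auto
    then have "\<forall>\<^sub>F x in F. \<alpha> \<le> g x / G x"
      by (intro eventually_mono[OF less_LiminfD]) auto
    with \<open>0 < ereal \<alpha>\<close> show ?thesis by auto
  qed
  have up_bound: "\<exists>\<beta>. \<forall>\<^sub>F x in F. g x / G x \<le> \<beta>"
    if fin: "Limsup F (\<lambda>x. ereal (g x / G x)) < \<infinity>" for F
  proof -
    obtain \<beta> where "Limsup F (\<lambda>x. ereal (g x / G x)) < ereal \<beta>"
      using ereal_dense2[OF fin] by auto
    then have "\<forall>\<^sub>F x in F. g x / G x \<le> \<beta>"
      by (intro eventually_mono[OF Limsup_lessD]) auto
    then show ?thesis ..
  qed
  obtain \<alpha> \<beta> \<alpha>' \<beta>' where "0 < \<alpha>" "\<forall>\<^sub>F x in to_upper u. \<alpha> \<le> g x / G x" "\<forall>\<^sub>F x in to_upper u. g x / G x \<le> \<beta>"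
    "0 < \<alpha>'" "\<forall>\<^sub>F x in to_lower l. \<alpha>' \<le> g x / G x" "\<forall>\<^sub>F x in to_lower l. g x / G x \<le> \<beta>'"
    using low_bound[OF upper(1)] up_bound[OF upper(2)] low_bound[OF lower(1)] up_bound[OF lower(2)] by blast
  then obtain k where k: "\<And>x. x \<in> S \<Longrightarrow> (\<phi> x - x * T x) * (\<phi> x + x * V x) \<le> k * (\<phi> x * g x)"
    by - (rule product_estimate[OF G' G(2) _ _ _ upper(3) _ _ _ lower(3)]; (assumption | rule that; assumption))
  show ?thesis
  proof (intro exI[of _ "2 * k"] allI impI, unfold Let_def)
    fix h :: "real \<Rightarrow> real"
    assume "\<exists>C. C-lipschitz_on UNIV h" "deriv_esssup h < \<infinity>"
    then obtain C where "C-lipschitz_on UNIV h" by blast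
    then obtain K where K: "deriv_esssup h = ereal K" "K-lipschitz_on UNIV h"
      using \<open>deriv_esssup h < \<infinity>\<close> by (rule lipschitz_on_deriv_esssup)
    have "0 \<le> K" using K(2) by (rule lipschitz_on_nonneg)
    define m where "m = integral\<^sup>L M (\<lambda>\<omega>. h (Z \<omega>))"
    define f where "f = stein_solution g \<rho> l h m"
    have "h \<in> borel_measurable borel"
      by (rule borel_measurable_continuous_onI[OF lipschitz_on_continuous_on[OF K(2)]])
    then have m: "m = (LBINT y=l..u. h y * \<rho> y)"
      by (simp add: m_def law(1))
    have f: "f differentiable (at x) \<and> g x * deriv f x - x * f x = h x - m \<and> \<bar>deriv f x\<bar> \<le> 2 * k * K"
      if x: "x \<in> S" for x
    proof (rule stein_solution_derivative[OF K(2) m x])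
      fix f' assume f': "(stein_solution g \<rho> l h m has_real_derivative f') (at x)"
        "g x * f' - x * stein_solution g \<rho> l h m x = h x - m"
        "\<bar>f'\<bar> * (\<phi> x * g x) \<le> 2 * K * ((\<phi> x - x * T x) * (\<phi> x + x * V x))"
      have "2 * K * ((\<phi> x - x * T x) * (\<phi> x + x * V x)) \<le> 2 * K * (k * (\<phi> x * g x))"
        using k[OF x] \<open>0 \<le> K\<close> by (intro mult_left_mono) auto
      with f'(3) have "\<bar>f'\<bar> * (\<phi> x * g x) \<le> (2 * k * K) * (\<phi> x * g x)"
        by (simp add: mult_ac)
      then have "\<bar>f'\<bar> \<le> 2 * k * K"
        using \<phi>_pos[OF x] g_pos[OF x] by (simp add: mult_le_cancel_right)
      moreover have "deriv f x = f'" unfolding f_def by (rule DERIV_imp_deriv[OF f'(1)])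
      moreover have "f differentiable (at x)"
        unfolding f_def using f'(1) real_differentiable_def by blast
      ultimately show ?thesis using f'(2) by (simp add: f_def)
    qed
    show "(\<forall>x\<in>S. stein_solution g \<rho> l h (integral\<^sup>L M (\<lambda>\<omega>. h (Z \<omega>))) differentiable (at x) \<and>
        g x * deriv (stein_solution g \<rho> l h (integral\<^sup>L M (\<lambda>\<omega>. h (Z \<omega>)))) x
          - x * stein_solution g \<rho> l h (integral\<^sup>L M (\<lambda>\<omega>. h (Z \<omega>))) x
        = h x - integral\<^sup>L M (\<lambda>\<omega>. h (Z \<omega>))) \<and>
      (SUP x\<in>S. ereal \<bar>deriv (stein_solution g \<rho> l h (integral\<^sup>L M (\<lambda>\<omega>. h (Z \<omega>)))) x\<bar>)
        \<le> ereal (2 * k) * deriv_esssup h"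
      unfolding m_def[symmetric] f_def[symmetric] K(1)
      using f by (auto intro!: SUP_least)
  qed
qed

end
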